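(* Let $2<h\le 4$. There exists a centered Gaussian process $\zeta=(\zeta_t)_{t\ge 0}$ with covariance $$E\zeta_s\zeta_t=K(s,t)=(2-h)\left(s^h+t^h-\frac12\left[(s+t)^h+|s-t|^h\right]\right),\qquad s,t\ge 0.$$ This process has a representation $$\zeta_t=\left(\frac12h(h-1)(h-2)\right)^{1/2}\int_0^t\vartheta_s\,ds,\qquad t\ge 0,$$ where $\vartheta=(\vartheta_t)_{t\ge 0}$ is a centered continuous Gaussian process with covariance $$K_0(s,t)=(s+t)^{h-2}-|s-t|^{h-2},\qquad s,t\ge 0.$$
   Context: The representation includes the assertion that a centered Gaussian process $\vartheta$ with continuous paths and covariance $K_0$ exists, and that the process defined by the right-hand side is centered Gaussian with covariance $K$ (so that the representation of $\zeta$ holds in the sense of equality in distribution). *)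

theory Defs
  imports "HOL-Probability.Probability"
begin

text \<open>Processes indexed by \<open>[0, \<infinity>)\<close> are functions \<open>real \<Rightarrow> 'a \<Rightarrow> real\<close>; only the values at times
  \<open>t \<ge> 0\<close> are ever used.\<close>

text \<open>Degenerate (almost surely constant) laws count as Gaussian. This is needed here: both
  covariances vanish at time \<open>0\<close>, and for \<open>h = 4\<close> they have rank one (\<open>12 s\<^sup>2 t\<^sup>2\<close> and \<open>4 s t\<close>).\<close>

definition gaussian_rv :: "'a measure \<Rightarrow> ('a \<Rightarrow> real) \<Rightarrow> bool" where
  "gaussian_rv M X \<longleftrightarrow> X \<in> borel_measurable M \<and>
     (\<exists>\<mu>. (\<exists>\<sigma>>0. distributed M lborel X (normal_density \<mu> \<sigma>)) \<or> (AE \<omega> in M. X \<omega> = \<mu>))"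

definition gaussian_process :: "'a measure \<Rightarrow> (real \<Rightarrow> 'a \<Rightarrow> real) \<Rightarrow> bool" where
  "gaussian_process M X \<longleftrightarrow> prob_space M \<and>
     (\<forall>J a. finite J \<longrightarrow> J \<subseteq> {0..} \<longrightarrow> gaussian_rv M (\<lambda>\<omega>. \<Sum>t\<in>J. a t * X t \<omega>))"

text \<open>The expectations below exist, because Gaussian variables are square integrable.\<close>

definition centered_gaussian_process ::
  "'a measure \<Rightarrow> (real \<Rightarrow> 'a \<Rightarrow> real) \<Rightarrow> (real \<Rightarrow> real \<Rightarrow> real) \<Rightarrow> bool" where
  "centered_gaussian_process M X C \<longleftrightarrow> gaussian_process M X \<and>
     (\<forall>t\<ge>0. prob_space.expectation M (X t) = 0) \<and>
     (\<forall>s\<ge>0. \<forall>t\<ge>0. prob_space.expectation M (\<lambda>\<omega>. X s \<omega> * X t \<omega>) = C s t)"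

definition continuous_paths :: "'a measure \<Rightarrow> (real \<Rightarrow> 'a \<Rightarrow> real) \<Rightarrow> bool" where
  "continuous_paths M X \<longleftrightarrow> (\<forall>\<omega>\<in>space M. continuous_on {0..} (\<lambda>t. X t \<omega>))"

text \<open>Equality in distribution of processes: equality of all finite-dimensional distributions.\<close>

definition same_distribution ::
  "'a measure \<Rightarrow> (real \<Rightarrow> 'a \<Rightarrow> real) \<Rightarrow> 'b measure \<Rightarrow> (real \<Rightarrow> 'b \<Rightarrow> real) \<Rightarrow> bool" where
  "same_distribution M X N Y \<longleftrightarrow>
     (\<forall>J. finite J \<longrightarrow> J \<subseteq> {0..} \<longrightarrow>
        distr M (\<Pi>\<^sub>M t\<in>J. (borel :: real measure)) (\<lambda>\<omega>. \<lambda>t\<in>J. X t \<omega>) =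
        distr N (\<Pi>\<^sub>M t\<in>J. (borel :: real measure)) (\<lambda>\<omega>. \<lambda>t\<in>J. Y t \<omega>))"

definition K :: "real \<Rightarrow> real \<Rightarrow> real \<Rightarrow> real" where
  "K h s t = (2 - h) *
     (s powr h + t powr h - 1/2 * ((s + t) powr h + \<bar>s - t\<bar> powr h))"

definition K0 :: "real \<Rightarrow> real \<Rightarrow> real \<Rightarrow> real" where
  "K0 h s t = (s + t) powr (h - 2) - \<bar>s - t\<bar> powr (h - 2)"

definition integrated_process :: "real \<Rightarrow> (real \<Rightarrow> 'a \<Rightarrow> real) \<Rightarrow> real \<Rightarrow> 'a \<Rightarrow> real" where
  "integrated_process h \<theta> t \<omega> =
     sqrt (1/2 * h * (h - 1) * (h - 2)) * integral {0..t} (\<lambda>s. \<theta> s \<omega>)"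

end

(*
  With alpha = h - 2 the kernel K0 is (s+t)^alpha - |s-t|^alpha, a positive multiple of
  the integral of 2 sin(sy) sin(ty) y^(-1-alpha) over y > 0 when alpha < 2, and 4 s t when alpha = 2.
  Hence it is positive semidefinite, and an increment of a process with this covariance has
  variance at most 4 |s-t|^alpha.  A Cholesky factorisation realises the covariance on the dyadic
  rationals as finite linear combinations of independent standard normals, and Kolmogorov's
  chaining argument with a high even moment extends the process continuously to [0, infinity).

  Up to the factor h(h-1)(h-2)/2, K0 is the mixed second derivative of K, which vanishes when s = 0
  or t = 0.  So the covariances of the Riemann sums of a continuous theta with covariance K0 converge to K;
  a pointwise limit of centered Gaussian families with converging covariances is Gaussian
  by characteristic functions.  Finally, by the Cramer-Wold theorem the covariance determines the
  finite-dimensional laws.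
*)

theory Submission
  imports Defs
begin

text \<open>The obstacle is degeneracy: both covariances vanish at time 0 and have rank one for h =
  4, so there are no joint densities and no covariance matrices to invert. The function exp (- v /
  2) treats v = 0 and v > 0 alike, which is why Gaussianity is handled through characteristic
  functions. The bound h \<le> 4 means \<alpha> \<le> 2. For \<alpha> < 2 the spectral integrals
  converge at 0 because 1 - cos vanishes there to second order; at \<alpha> = 2 they diverge, and
  the kernel is a product instead. For small \<alpha> the variance bound alone is too weak for
  chaining. Gaussianity makes the moment of order 2p a multiple of the p-th power of the variance,
  so a large p gains any power of the mesh. The mixed derivative of \<open>K\<close> kills the pure
  powers and leaves (2 - h) times -1/2 times h (h - 1) times \<open>K0\<close>, which is the stated
  constant; covariances are quadratic, hence the square root before the integral.\<close>

subsection \<open>Characteristic functions of centered Gaussian variables\<close>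

text \<open>Scaling a standard normal variable, instead of using a density, makes v = 0 the point
  mass at 0.\<close>

definition centered_normal :: "real \<Rightarrow> real measure" where
  "centered_normal v = distr std_normal_distribution borel (\<lambda>z. sqrt v * z)"

lemma prob_space_std_normal: "prob_space std_normal_distribution"
  by (rule prob_space_normal_density) simp

lemma real_distribution_centered_normal: "real_distribution (centered_normal v)"
  unfolding centered_normal_def
  by (intro prob_space.real_distribution_distr prob_space_std_normal) simp

lemma char_centered_normal:
  assumes "0 \<le> v"
  shows "char (centered_normal v) u = of_real (exp (- (u\<^sup>2 * v) / 2))"
proof -
  have "char (centered_normal v) u = (CLINT z|std_normal_distribution. iexp ((u * sqrt v) * z))"
    unfolding char_def centered_normal_def by (subst integral_distr) (auto simp: ac_simps)
  also have "\<dots> = char std_normal_distribution (u * sqrt v)"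
    by (simp add: char_def)
  also have "\<dots> = of_real (exp (- (u\<^sup>2 * v) / 2))"
    using assms by (simp add: char_std_normal_distribution power_mult_distrib)
  finally show ?thesis .
qed

text \<open>Nonnegativity of v is a conclusion: a characteristic function has modulus at most 1, and
  at u = 1 this reads exp (- v / 2) \<le> 1. The law then follows from Levy's uniqueness
  theorem.\<close>

lemma distr_centered_normal_if_chf:
  assumes "prob_space M" and X[measurable]: "X \<in> borel_measurable M"
    and chf: "\<And>u. (CLINT \<omega>|M. iexp (u * X \<omega>)) = of_real (exp (- (u\<^sup>2 * v) / 2))"
  shows "0 \<le> v" and "distr M borel X = centered_normal v"
proof -
  interpret prob_space M by fact
  interpret D: real_distribution "distr M borel X"
    by (intro real_distribution_distr) simp
  have char: "char (distr M borel X) u = of_real (exp (- (u\<^sup>2 * v) / 2))" for u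
    unfolding char_def using chf by (simp add: integral_distr)
  have "norm (char (distr M borel X) 1) \<le> 1"
    by (rule D.cmod_char_le_1)
  then show v: "0 \<le> v"
    unfolding char by simp
  show "distr M borel X = centered_normal v"
    using D.real_distribution_axioms real_distribution_centered_normal
    by (rule Levy_uniqueness) (simp add: fun_eq_iff char char_centered_normal v)
qed

lemma has_bochner_integral_distr_iff:
  fixes f :: "'b \<Rightarrow> real"
  assumes "X \<in> measurable M N" and "f \<in> borel_measurable N"
  shows "has_bochner_integral (distr M N X) f c \<longleftrightarrow> has_bochner_integral M (\<lambda>\<omega>. f (X \<omega>)) c"
  using assms by (simp add: has_bochner_integral_iff integrable_distr_eq integral_distr)

lemma has_bochner_integral_centered_normal_power:
  assumes X: "X \<in> borel_measurable M" and D: "distr M borel X = centered_normal v"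
    and v: "0 \<le> v"
  shows "has_bochner_integral M (\<lambda>\<omega>. X \<omega> ^ (2 * k)) (v ^ k * (fact (2 * k) / (2 ^ k * fact k)))"
    and "has_bochner_integral M X 0"
proof -
  have iff: "has_bochner_integral M (\<lambda>\<omega>. f (X \<omega>)) c \<longleftrightarrow>
    has_bochner_integral std_normal_distribution (\<lambda>z. f (sqrt v * z)) c"
    if f: "f \<in> borel_measurable borel" for f :: "real \<Rightarrow> real" and c
    using has_bochner_integral_distr_iff[OF X f, of c]
      has_bochner_integral_distr_iff[of "\<lambda>z. sqrt v * z" std_normal_distribution borel f c] f
    by (simp add: D centered_normal_def)
  have "has_bochner_integral std_normal_distribution (\<lambda>z. z ^ (2 * k)) (fact (2 * k) / (2 ^ k * fact k))"
    using std_normal_distribution_even_moments[of k] by (simp add: has_bochner_integral_iff)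
  from has_bochner_integral_mult_right[OF this, of "v ^ k"]
  have "has_bochner_integral std_normal_distribution (\<lambda>z. (sqrt v * z) ^ (2 * k))
      (v ^ k * (fact (2 * k) / (2 ^ k * fact k)))"
    using v by (simp add: power_mult_distrib power_mult)
  then show "has_bochner_integral M (\<lambda>\<omega>. X \<omega> ^ (2 * k)) (v ^ k * (fact (2 * k) / (2 ^ k * fact k)))"
    by (subst iff) simp_all
  have "has_bochner_integral std_normal_distribution (\<lambda>z. z) 0"
    using integral_std_normal_distribution_moment_odd[of 1]
      integrable_std_normal_distribution_moment[of 1] by (simp add: has_bochner_integral_iff)
  from has_bochner_integral_mult_right[OF this, of "sqrt v"]
  show "has_bochner_integral M X 0"
    using iff[of "\<lambda>x. x" 0] by simp
qed

text \<open>\<open>gaussian_rv\<close> separates the two kinds of law that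
  \<open>centered_normal\<close> merges, so the proof splits on v = 0.\<close>

lemma gaussian_rv_if_distr_centered_normal:
  assumes "prob_space M" and X[measurable]: "X \<in> borel_measurable M"
    and D: "distr M borel X = centered_normal v" and v: "0 \<le> v"
  shows "gaussian_rv M X"
proof (cases "v = 0")
  case True
  interpret prob_space M by fact
  have "AE x in centered_normal 0. x = 0"
    unfolding centered_normal_def by (subst AE_distr_iff) auto
  then have "AE x in distr M borel X. x = 0"
    unfolding D True .
  then have "AE \<omega> in M. X \<omega> = 0"
    by (subst (asm) AE_distr_iff) auto
  then show ?thesis
    by (auto simp: gaussian_rv_def)
next
  case False
  then have pos: "0 < sqrt v"
    using v by simp
  interpret S: prob_space std_normal_distribution
    by (rule prob_space_std_normal)
  have "distributed std_normal_distribution lborel (\<lambda>z. z) (normal_density 0 1)"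
  proof -
    have "distr std_normal_distribution lborel (\<lambda>z. z) = std_normal_distribution"
      by (metis distr_id2 sets_density)
    then show ?thesis
      by (auto simp: distributed_def)
  qed
  from S.normal_density_affine[OF this, of "sqrt v" 0] pos
  have "distributed std_normal_distribution lborel (\<lambda>z. sqrt v * z) (normal_density 0 (sqrt v))"
    by simp
  then have "distr std_normal_distribution lborel (\<lambda>z. sqrt v * z) = density lborel (normal_density 0 (sqrt v))"
    by (simp add: distributed_def)
  \<comment> \<open>\<open>distributed\<close> pushes forward to \<open>lborel\<close>,
    \<open>centered_normal\<close> to \<open>borel\<close>; both have the same measurable sets, and
    \<open>distr\<close> sees nothing else of its target.\<close>
  moreover have "distr M lborel X = distr M borel X"
    by (rule distr_cong) simp_all
  moreover have "distr std_normal_distribution lborel f = distr std_normal_distribution borel f" for f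
    by (rule distr_cong) simp_all
  ultimately have "distr M lborel X = density lborel (normal_density 0 (sqrt v))"
    using D by (metis centered_normal_def)
  then have "distributed M lborel X (normal_density 0 (sqrt v))"
    by (auto simp: distributed_def)
  then show ?thesis
    using X pos unfolding gaussian_rv_def by blast
qed

text \<open>The argument u = 1 is enough for later use, since coefficients of linear combinations
  absorb u. In the degenerate case the vanishing mean forces the constant, and with it v, to be
  0.\<close>

lemma chf_if_gaussian_rv:
  assumes "prob_space M" and gauss: "gaussian_rv M X"
    and mean: "prob_space.expectation M X = 0"
    and var: "prob_space.expectation M (\<lambda>\<omega>. (X \<omega>)\<^sup>2) = v"
  shows "(CLINT \<omega>|M. iexp (X \<omega>)) = of_real (exp (- v / 2))"
proof -
  interpret prob_space M by fact
  have X[measurable]: "X \<in> borel_measurable M"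
    using gauss by (simp add: gaussian_rv_def)
  consider (nondeg) \<mu> \<sigma> where "\<sigma> > 0" "distributed M lborel X (normal_density \<mu> \<sigma>)"
    | (const) \<mu> where "AE \<omega> in M. X \<omega> = \<mu>"
    using gauss by (auto simp: gaussian_rv_def)
  then show ?thesis
  proof cases
    case nondeg
    have \<mu>: "\<mu> = 0"
      using normal_distributed_expectation[OF nondeg] mean by simp
    have v: "v = \<sigma>\<^sup>2"
      using normal_distributed_variance[OF nondeg] mean var by simp
    have Z: "distributed M lborel (\<lambda>\<omega>. (X \<omega> - \<mu>) / \<sigma>) std_normal_density"
      using nondeg normal_standard_normal_convert by blast
    have "(CLINT \<omega>|M. iexp (X \<omega>)) = (CLINT \<omega>|M. iexp (\<sigma> * ((X \<omega> - \<mu>) / \<sigma>)))"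
      using nondeg(1) \<mu> by simp
    also have "\<dots> = char (distr M lborel (\<lambda>\<omega>. (X \<omega> - \<mu>) / \<sigma>)) \<sigma>"
      unfolding char_def by (subst integral_distr) auto
    also have "\<dots> = char std_normal_distribution \<sigma>"
      using Z by (simp add: distributed_def)
    finally show ?thesis
      by (simp add: char_std_normal_distribution v)
  next
    case const
    have "expectation X = expectation (\<lambda>\<omega>. \<mu>)"
      using const by (intro integral_cong_AE) auto
    then have \<mu>: "\<mu> = 0"
      using mean prob_space by simp
    have "expectation (\<lambda>\<omega>. (X \<omega>)\<^sup>2) = expectation (\<lambda>\<omega>. 0)"
      using const \<mu> by (intro integral_cong_AE) auto
    then have "v = 0"
      using var by simp
    moreover have "(CLINT \<omega>|M. iexp (X \<omega>)) = (CLINT \<omega>|M. 1)"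
      using const \<mu> by (intro integral_cong_AE) auto
    ultimately show ?thesis
      using prob_space by simp
  qed
qed

text \<open>The integral of a non-integrable function is 0 by convention, so the moment equations in
  \<open>centered_gaussian_process\<close> can be combined linearly only once integrability is
  known.\<close>

lemma square_integrable_gaussian_rv:
  assumes "prob_space M" and gauss: "gaussian_rv M X"
  shows "integrable M X" and "integrable M (\<lambda>\<omega>. (X \<omega>)\<^sup>2)"
proof -
  interpret prob_space M by fact
  have X[measurable]: "X \<in> borel_measurable M"
    using gauss by (simp add: gaussian_rv_def)
  consider (nondeg) \<mu> \<sigma> where "\<sigma> > 0" "distributed M lborel X (normal_density \<mu> \<sigma>)"
    | (const) \<mu> where "AE \<omega> in M. X \<omega> = \<mu>"
    using gauss by (auto simp: gaussian_rv_def)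
  then have "integrable M (\<lambda>\<omega>. (X \<omega>)\<^sup>2) \<and> integrable M X"
  proof cases
    case nondeg
    let ?n = "normal_density \<mu> \<sigma>"
    have 0: "integrable lborel ?n" and 1: "integrable lborel (\<lambda>x. ?n x * x)"
      and "integrable lborel (\<lambda>x. ?n x * (x - \<mu>)^2)"
      using nondeg(1) integrable_normal_moment[of \<sigma> \<mu> 2] integrable_normal_moment_nz_1[of \<sigma> \<mu>] by auto
    \<comment> \<open>The available second moment is the central one, hence x^2 is written as (x -
      \<mu>)^2 + 2 \<mu> x - \<mu>^2.\<close>
    then have "integrable lborel (\<lambda>x. ?n x * (x - \<mu>)^2 + 2 * \<mu> * (?n x * x) - \<mu>\<^sup>2 * ?n x)"
      by (intro Bochner_Integration.integrable_add Bochner_Integration.integrable_diff integrable_mult_right)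
    also have "(\<lambda>x. ?n x * (x - \<mu>)^2 + 2 * \<mu> * (?n x * x) - \<mu>\<^sup>2 * ?n x) = (\<lambda>x. ?n x * x\<^sup>2)"
      by (auto simp: power2_eq_square algebra_simps)
    finally have 2: "integrable lborel (\<lambda>x. ?n x * x\<^sup>2)" .
    show ?thesis
      using 1 2 distributed_integrable[OF nondeg(2), of "\<lambda>x. x"]
        distributed_integrable[OF nondeg(2), of "\<lambda>x. x\<^sup>2"] by simp
  next
    case const
    have "integrable M X"
      by (rule integrable_cong_AE_imp[where g="\<lambda>_. \<mu>"]) (use const in auto)
    moreover have "integrable M (\<lambda>\<omega>. (X \<omega>)\<^sup>2)"
      by (rule integrable_cong_AE_imp[where g="\<lambda>_. \<mu>\<^sup>2"]) (use const in auto)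
    ultimately show ?thesis by simp
  qed
  then show "integrable M X" and "integrable M (\<lambda>\<omega>. (X \<omega>)\<^sup>2)" by auto
qed

text \<open>Prescribing the characteristic functions of all linear combinations is equivalent to being centered
  Gaussian with covariance \<open>C\<close>, and is stable under limits and linear maps without separating the
  degenerate laws.\<close>

definition gaussian_family ::
  "'a measure \<Rightarrow> 'i set \<Rightarrow> ('i \<Rightarrow> 'a \<Rightarrow> real) \<Rightarrow> ('i \<Rightarrow> 'i \<Rightarrow> real) \<Rightarrow> bool" where
  "gaussian_family M T X C \<longleftrightarrow> prob_space M \<and> (\<forall>t\<in>T. X t \<in> borel_measurable M) \<and>
     (\<forall>J a. finite J \<longrightarrow> J \<subseteq> T \<longrightarrow>
        (CLINT \<omega>|M. iexp (\<Sum>t\<in>J. a t * X t \<omega>)) =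
        of_real (exp (- (\<Sum>s\<in>J. \<Sum>t\<in>J. a s * a t * C s t) / 2)))"

lemma gaussian_family_prob_space: "gaussian_family M T X C \<Longrightarrow> prob_space M"
  and gaussian_family_measurable: "gaussian_family M T X C \<Longrightarrow> t \<in> T \<Longrightarrow> X t \<in> borel_measurable M"
  and gaussian_family_chf: "gaussian_family M T X C \<Longrightarrow> finite J \<Longrightarrow> J \<subseteq> T \<Longrightarrow>
    (CLINT \<omega>|M. iexp (\<Sum>t\<in>J. a t * X t \<omega>)) =
      of_real (exp (- (\<Sum>s\<in>J. \<Sum>t\<in>J. a s * a t * C s t) / 2))"
  by (auto simp: gaussian_family_def)

text \<open>Multiplying all coefficients by u turns the single identity of
  \<open>gaussian_family\<close> into the whole characteristic function of the linear
  combination.\<close>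

lemma gaussian_family_distr:
  fixes a :: "'i \<Rightarrow> real"
  assumes G: "gaussian_family M T X C" and J: "finite J" "J \<subseteq> T"
  defines "v \<equiv> \<Sum>s\<in>J. \<Sum>t\<in>J. a s * a t * C s t"
  shows "0 \<le> v" and "distr M borel (\<lambda>\<omega>. \<Sum>t\<in>J. a t * X t \<omega>) = centered_normal v"
proof -
  have meas: "(\<lambda>\<omega>. \<Sum>t\<in>J. a t * X t \<omega>) \<in> borel_measurable M"
    using gaussian_family_measurable[OF G] J by (intro borel_measurable_sum borel_measurable_times) auto
  have chf: "(CLINT \<omega>|M. iexp (u * (\<Sum>t\<in>J. a t * X t \<omega>))) = of_real (exp (- (u\<^sup>2 * v) / 2))" for u
    using gaussian_family_chf[OF G J, of "\<lambda>t. u * a t"]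
    by (simp add: v_def sum_distrib_left mult.assoc power2_eq_square mult.left_commute)
  show "0 \<le> v" and "distr M borel (\<lambda>\<omega>. \<Sum>t\<in>J. a t * X t \<omega>) = centered_normal v"
    using distr_centered_normal_if_chf[OF gaussian_family_prob_space[OF G] meas chf] by auto
qed

text \<open>The case k = 1 yields the covariances; large k feeds the chaining estimate.\<close>

lemma gaussian_family_moments:
  fixes a :: "'i \<Rightarrow> real"
  assumes G: "gaussian_family M T X C" and J: "finite J" "J \<subseteq> T"
  defines "v \<equiv> \<Sum>s\<in>J. \<Sum>t\<in>J. a s * a t * C s t"
  shows "has_bochner_integral M (\<lambda>\<omega>. (\<Sum>t\<in>J. a t * X t \<omega>) ^ (2 * k))
      (v ^ k * (fact (2 * k) / (2 ^ k * fact k)))"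
    and "has_bochner_integral M (\<lambda>\<omega>. \<Sum>t\<in>J. a t * X t \<omega>) 0"
proof -
  have meas: "(\<lambda>\<omega>. \<Sum>t\<in>J. a t * X t \<omega>) \<in> borel_measurable M"
    using gaussian_family_measurable[OF G] J by (intro borel_measurable_sum borel_measurable_times) auto
  note * = has_bochner_integral_centered_normal_power[OF meas gaussian_family_distr(2)[OF G J]
      gaussian_family_distr(1)[OF G J]]
  show "has_bochner_integral M (\<lambda>\<omega>. (\<Sum>t\<in>J. a t * X t \<omega>) ^ (2 * k))
      (v ^ k * (fact (2 * k) / (2 ^ k * fact k)))"
    and "has_bochner_integral M (\<lambda>\<omega>. \<Sum>t\<in>J. a t * X t \<omega>) 0"
    using * unfolding v_def by blast+
qed

lemma centered_gaussian_process_if_gaussian_family: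
  assumes G: "gaussian_family M {0..} X C" and sym: "\<And>s t. C s t = C t s"
  shows "centered_gaussian_process M X C"
proof -
  interpret prob_space M by (rule gaussian_family_prob_space[OF G])
  have "gaussian_rv M (\<lambda>\<omega>. \<Sum>t\<in>J. a t * X t \<omega>)" if J: "finite J" "J \<subseteq> {0..}" for J a
  proof (rule gaussian_rv_if_distr_centered_normal[OF prob_space_axioms _ gaussian_family_distr(2)[OF G J]
      gaussian_family_distr(1)[OF G J]])
    show "(\<lambda>\<omega>. \<Sum>t\<in>J. a t * X t \<omega>) \<in> borel_measurable M"
      using gaussian_family_measurable[OF G] J by (intro borel_measurable_sum borel_measurable_times) auto
  qed
  moreover have mean: "has_bochner_integral M (X t) 0" if "0 \<le> t" for t
    using gaussian_family_moments(2)[OF G, of "{t}" "\<lambda>_. 1"] that by simp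
  moreover have sq: "has_bochner_integral M (\<lambda>\<omega>. (X t \<omega>)\<^sup>2) (C t t)" if "0 \<le> t" for t
    using gaussian_family_moments(1)[OF G, of "{t}" "\<lambda>_. 1" 1] that by simp
  moreover have "has_bochner_integral M (\<lambda>\<omega>. X s \<omega> * X t \<omega>) (C s t)" if "0 \<le> s" "0 \<le> t" for s t
  \<comment> \<open>The mixed moment comes from polarising the second moment of X s + X t. This
    needs s \<noteq> t, because {s, t} must have two elements for the sum over it to be X s + X
    t.\<close>
  proof (cases "s = t")
    case True
    then show ?thesis using sq[of t] that by (simp add: power2_eq_square)
  next
    case False
    then have "has_bochner_integral M (\<lambda>\<omega>. (X s \<omega> + X t \<omega>)\<^sup>2) (C s s + C t t + 2 * C s t)"
      using gaussian_family_moments(1)[OF G, of "{s, t}" "\<lambda>_. 1" 1] that sym[of s t]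
      by (simp add: algebra_simps power2_eq_square)
    then have "has_bochner_integral M (\<lambda>\<omega>. ((X s \<omega> + X t \<omega>)\<^sup>2 - (X s \<omega>)\<^sup>2 - (X t \<omega>)\<^sup>2) / 2)
      ((C s s + C t t + 2 * C s t - C s s - C t t) / 2)"
      using sq that by (intro has_bochner_integral_divide_zero has_bochner_integral_diff) auto
    then show ?thesis
      by (simp add: power2_eq_square algebra_simps)
  qed
  ultimately show ?thesis
    unfolding centered_gaussian_process_def gaussian_process_def
    by (simp add: has_bochner_integral_integral_eq prob_space_axioms)
qed

text \<open>Squares dominate the products, so the second moment of a linear combination may be
  expanded into the quadratic form of C; the combination is Gaussian by assumption, and its mean and
  variance fix the characteristic function.\<close>

lemma gaussian_family_if_centered_gaussian_process:
  assumes "centered_gaussian_process M X C"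
  shows "gaussian_family M {0..} X C"
proof -
  interpret prob_space M
    using assms by (simp add: centered_gaussian_process_def gaussian_process_def)
  have gauss: "gaussian_rv M (\<lambda>\<omega>. \<Sum>t\<in>J. a t * X t \<omega>)" if "finite J" "J \<subseteq> {0..}" for J a
    using assms that by (simp add: centered_gaussian_process_def gaussian_process_def)
  have gauss1: "gaussian_rv M (X t)" if "0 \<le> t" for t
    using gauss[of "{t}" "\<lambda>_. 1"] that by simp
  then have meas: "X t \<in> borel_measurable M" if "0 \<le> t" for t
    using that by (simp add: gaussian_rv_def)
  note sq = square_integrable_gaussian_rv[OF prob_space_axioms]
  have prod: "integrable M (\<lambda>\<omega>. X s \<omega> * X t \<omega>)" if "0 \<le> s" "0 \<le> t" for s t
  proof (rule Bochner_Integration.integrable_bound)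
    show "integrable M (\<lambda>\<omega>. (X s \<omega>)\<^sup>2 + (X t \<omega>)\<^sup>2)"
      using sq(2)[OF gauss1] that by auto
    show "(\<lambda>\<omega>. X s \<omega> * X t \<omega>) \<in> borel_measurable M"
      using meas that by auto
    have "\<bar>x * y\<bar> \<le> x\<^sup>2 + y\<^sup>2" for x y :: real
      using sum_squares_bound[of "\<bar>x\<bar>" "\<bar>y\<bar>"] mult_nonneg_nonneg[of "\<bar>x\<bar>" "\<bar>y\<bar>"]
      unfolding abs_mult power2_abs mult.assoc by linarith
    then show "AE \<omega> in M. norm (X s \<omega> * X t \<omega>) \<le> norm ((X s \<omega>)\<^sup>2 + (X t \<omega>)\<^sup>2)"
      by auto
  qed
  have "(CLINT \<omega>|M. iexp (\<Sum>t\<in>J. a t * X t \<omega>)) =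
        of_real (exp (- (\<Sum>s\<in>J. \<Sum>t\<in>J. a s * a t * C s t) / 2))"
    if J: "finite J" "J \<subseteq> {0..}" for J a
  proof (rule chf_if_gaussian_rv[OF prob_space_axioms gauss[OF J]])
    have J0: "0 \<le> t" if "t \<in> J" for t
      using J that by auto
    have "expectation (\<lambda>\<omega>. \<Sum>t\<in>J. a t * X t \<omega>) = (\<Sum>t\<in>J. a t * expectation (X t))"
      using sq(1)[OF gauss1] J0 by (subst Bochner_Integration.integral_sum) auto
    also have "\<dots> = 0"
      using assms J0 by (simp add: centered_gaussian_process_def)
    finally show "expectation (\<lambda>\<omega>. \<Sum>t\<in>J. a t * X t \<omega>) = 0" .
    have "(\<Sum>t\<in>J. a t * X t \<omega>)\<^sup>2 = (\<Sum>s\<in>J. \<Sum>t\<in>J. a s * a t * (X s \<omega> * X t \<omega>))" for \<omega>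
      unfolding power2_eq_square sum_product by (simp add: ac_simps)
    then have "expectation (\<lambda>\<omega>. (\<Sum>t\<in>J. a t * X t \<omega>)\<^sup>2) =
      expectation (\<lambda>\<omega>. \<Sum>s\<in>J. \<Sum>t\<in>J. a s * a t * (X s \<omega> * X t \<omega>))"
      by simp
    also have "\<dots> = (\<Sum>s\<in>J. \<Sum>t\<in>J. a s * a t * expectation (\<lambda>\<omega>. X s \<omega> * X t \<omega>))"
      using prod J0
      by (subst Bochner_Integration.integral_sum)
         (auto intro!: Bochner_Integration.integrable_sum sum.cong integrable_mult_right
            simp: Bochner_Integration.integral_sum)
    also have "\<dots> = (\<Sum>s\<in>J. \<Sum>t\<in>J. a s * a t * C s t)"
      using assms J0 by (intro sum.cong) (auto simp: centered_gaussian_process_def)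
    finally show "expectation (\<lambda>\<omega>. (\<Sum>t\<in>J. a t * X t \<omega>)\<^sup>2) = (\<Sum>s\<in>J. \<Sum>t\<in>J. a s * a t * C s t)" .
  qed
  then show ?thesis
    using meas prob_space_axioms by (simp add: gaussian_family_def)
qed

subsection \<open>Uniqueness of finite-dimensional laws\<close>

text \<open>The weights act as densities. At u = 0 the hypothesis says that they have the same total
  mass m; if m = 0 both integrals vanish, otherwise division by m gives probability laws to which
  Levy uniqueness applies. The bound 2 fits the weights of the form 1 + cos.\<close>

lemma weighted_law_eq_if_chf_eq:
  fixes X f :: "'a \<Rightarrow> real" and Y g :: "'b \<Rightarrow> real"
  assumes "prob_space M" and "prob_space N"
    and X[measurable]: "X \<in> borel_measurable M" and Y[measurable]: "Y \<in> borel_measurable N"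
    and f[measurable]: "f \<in> borel_measurable M" and g[measurable]: "g \<in> borel_measurable N"
    and f2: "\<And>\<omega>. 0 \<le> f \<omega> \<and> f \<omega> \<le> 2" and g2: "\<And>\<omega>. 0 \<le> g \<omega> \<and> g \<omega> \<le> 2"
    and chf: "\<And>u. (CLINT \<omega>|M. of_real (f \<omega>) * iexp (u * X \<omega>)) = (CLINT \<omega>|N. of_real (g \<omega>) * iexp (u * Y \<omega>))"
    and B[measurable]: "B \<in> sets borel"
  shows "(LINT \<omega>|M. f \<omega> * indicator B (X \<omega>)) = (LINT \<omega>|N. g \<omega> * indicator B (Y \<omega>))"
proof -
  interpret M: prob_space M by fact
  interpret N: prob_space N by fact
  have intf: "integrable M f"
    by (rule M.integrable_const_bound[where B=2]) (use f2 in auto)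
  have intg: "integrable N g"
    by (rule N.integrable_const_bound[where B=2]) (use g2 in auto)
  define m where "m = (LINT \<omega>|M. f \<omega>)"
  have mg: "m = (LINT \<omega>|N. g \<omega>)"
    using chf[of 0] by (simp add: m_def del: of_real_mult)
  have m0: "0 \<le> m"
    unfolding m_def using f2 by (intro integral_nonneg_AE) auto
  show ?thesis
  proof (cases "m = 0")
    case True
    have "AE \<omega> in M. f \<omega> = 0"
      using integral_nonneg_eq_0_iff_AE[OF intf] f2 True m_def by auto
    then have "(LINT \<omega>|M. f \<omega> * indicator B (X \<omega>)) = (LINT \<omega>|M. 0)"
      by (intro integral_cong_AE) auto
    moreover have "AE \<omega> in N. g \<omega> = 0"
      using integral_nonneg_eq_0_iff_AE[OF intg] g2 True mg by auto
    then have "(LINT \<omega>|N. g \<omega> * indicator B (Y \<omega>)) = (LINT \<omega>|N. 0)"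
      by (intro integral_cong_AE) auto
    ultimately show ?thesis by simp
  next
    case False
    then have m: "0 < m" using m0 by simp
    define D where "D = distr (density M (\<lambda>\<omega>. ennreal (f \<omega> / m))) borel X"
    define E where "E = distr (density N (\<lambda>\<omega>. ennreal (g \<omega> / m))) borel Y"
    have "prob_space (density M (\<lambda>\<omega>. ennreal (f \<omega> / m)))"
    proof
      have "(\<integral>\<^sup>+\<omega>. ennreal (f \<omega> / m) \<partial>M) = ennreal (LINT \<omega>|M. f \<omega> / m)"
        using f2 m intf by (intro nn_integral_eq_integral) auto
      then show "emeasure (density M (\<lambda>\<omega>. ennreal (f \<omega> / m))) (space (density M (\<lambda>\<omega>. ennreal (f \<omega> / m)))) = 1"
        using m by (simp add: emeasure_density m_def[symmetric] cong: nn_integral_cong)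
    qed
    then have D: "real_distribution D"
      unfolding D_def by (rule prob_space.real_distribution_distr) simp
    have "prob_space (density N (\<lambda>\<omega>. ennreal (g \<omega> / m)))"
    proof
      have "(\<integral>\<^sup>+\<omega>. ennreal (g \<omega> / m) \<partial>N) = ennreal (LINT \<omega>|N. g \<omega> / m)"
        using g2 m intg by (intro nn_integral_eq_integral) auto
      then show "emeasure (density N (\<lambda>\<omega>. ennreal (g \<omega> / m))) (space (density N (\<lambda>\<omega>. ennreal (g \<omega> / m)))) = 1"
        using m by (simp add: emeasure_density mg[symmetric] cong: nn_integral_cong)
    qed
    then have E: "real_distribution E"
      unfolding E_def by (rule prob_space.real_distribution_distr) simp
    have charD: "char D u = (CLINT \<omega>|M. of_real (f \<omega>) * iexp (u * X \<omega>)) / of_real m" for u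
      unfolding char_def D_def using f2 m
      by (subst integral_distr) (auto simp: integral_density scaleR_conv_of_real field_simps)
    have charE: "char E u = (CLINT \<omega>|N. of_real (g \<omega>) * iexp (u * Y \<omega>)) / of_real m" for u
      unfolding char_def E_def using g2 m
      by (subst integral_distr) (auto simp: integral_density scaleR_conv_of_real field_simps)
    have "char D = char E"
      unfolding fun_eq_iff charD charE chf by simp
    then have DE: "D = E"
      by (rule Levy_uniqueness[OF D E])
    have "(LINT x|D. indicator B x) = (LINT \<omega>|M. f \<omega> * indicator B (X \<omega>)) / m"
      unfolding D_def using f2 m by (subst integral_distr) (auto simp: integral_density field_simps)
    moreover have "(LINT x|E. indicator B x) = (LINT \<omega>|N. g \<omega> * indicator B (Y \<omega>)) / m"
      unfolding E_def using g2 m by (subst integral_distr) (auto simp: integral_density field_simps)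
    ultimately show ?thesis
      using DE m by simp
  qed
qed

text \<open>The Cramer-Wold theorem is proved by replacing exponentials with indicators one coordinate at a
  time; \<open>mixed_chf\<close> has indicators on \<open>A\<close> and exponentials on \<open>D\<close>.\<close>

definition mixed_chf ::
  "'a measure \<Rightarrow> ('i \<Rightarrow> 'a \<Rightarrow> real) \<Rightarrow> ('i \<Rightarrow> real set) \<Rightarrow> 'i set \<Rightarrow> 'i set \<Rightarrow> ('i \<Rightarrow> real) \<Rightarrow> complex" where
  "mixed_chf M X B A D a =
     (CLINT \<omega>|M. of_real (\<Prod>t\<in>A. indicator (B t) (X t \<omega>)) * iexp (\<Sum>t\<in>D. a t * X t \<omega>))"

lemma prod_indicator_bounds:
  fixes x :: "'i \<Rightarrow> real"
  shows "0 \<le> (\<Prod>t\<in>A. indicator (B t) (x t) :: real)" and "(\<Prod>t\<in>A. indicator (B t) (x t) :: real) \<le> 1"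
  by (auto intro!: prod_nonneg prod_le_1)

lemma integrable_mixed_chf:
  assumes "prob_space M" and X: "\<And>t. t \<in> A \<union> D \<Longrightarrow> X t \<in> borel_measurable M"
    and B: "\<And>t. t \<in> A \<Longrightarrow> B t \<in> sets borel"
  shows "integrable M (\<lambda>\<omega>. of_real (\<Prod>t\<in>A. indicator (B t) (X t \<omega>)) * iexp (\<Sum>t\<in>D. a t * X t \<omega>))"
proof (rule finite_measure.integrable_const_bound[where B=1])
  show "finite_measure M"
    using assms(1) by (simp add: prob_space.finite_measure)
  have "cmod (of_real (\<Prod>t\<in>A. indicator (B t) (X t \<omega>)) * iexp (\<Sum>t\<in>D. a t * X t \<omega>)) \<le> 1" for \<omega>
    using prod_indicator_bounds[where B=B and A=A and x="\<lambda>t. X t \<omega>"] by (simp add: norm_mult del: of_real_sum of_real_prod)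
  then show "AE \<omega> in M. cmod (of_real (\<Prod>t\<in>A. indicator (B t) (X t \<omega>)) * iexp (\<Sum>t\<in>D. a t * X t \<omega>)) \<le> 1"
    by simp
  have [measurable]: "(\<lambda>\<omega>. \<Prod>t\<in>A. indicator (B t) (X t \<omega>) :: real) \<in> borel_measurable M"
    using X B by (intro borel_measurable_prod measurable_compose[OF _ borel_measurable_indicator]) auto
  have [measurable]: "(\<lambda>\<omega>. \<Sum>t\<in>D. a t * X t \<omega>) \<in> borel_measurable M"
    using X by (intro borel_measurable_sum borel_measurable_times) auto
  show "(\<lambda>\<omega>. of_real (\<Prod>t\<in>A. indicator (B t) (X t \<omega>)) * iexp (\<Sum>t\<in>D. a t * X t \<omega>)) \<in> borel_measurable M"
    by measurable
qed


text \<open>The real weight \<open>1 + cos R\<close> with \<open>R = \<Sum>t\<in>D. a t * X t\<close> is nonnegative, so weighting with it gives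
  a measure, and its product with \<open>iexp (u * X s)\<close> is a combination of characters.\<close>

lemma chf_cos_weight:
  assumes "prob_space M" and D: "finite D" "s \<notin> D" and X: "\<And>t. t \<in> A \<union> insert s D \<Longrightarrow> X t \<in> borel_measurable M"
    and B: "\<And>t. t \<in> A \<Longrightarrow> B t \<in> sets borel"
  shows "(CLINT \<omega>|M. of_real ((\<Prod>t\<in>A. indicator (B t) (X t \<omega>)) * (1 + cos (c + (\<Sum>t\<in>D. a t * X t \<omega>)))) * iexp (u * X s \<omega>)) =
    mixed_chf M X B A {s} (\<lambda>_. u) + (iexp c * mixed_chf M X B A (insert s D) (a(s := u)) +
      iexp (- c) * mixed_chf M X B A (insert s D) ((\<lambda>t. - a t)(s := u))) / 2"
proof -
  have sums: "(\<Sum>t\<in>insert s D. (a(s := u)) t * X t \<omega>) = u * X s \<omega> + (\<Sum>t\<in>D. a t * X t \<omega>)"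
    "(\<Sum>t\<in>insert s D. ((\<lambda>t. - a t)(s := u)) t * X t \<omega>) = u * X s \<omega> - (\<Sum>t\<in>D. a t * X t \<omega>)" for \<omega>
  proof -
    have "(\<Sum>t\<in>D. (a(s := u)) t * X t \<omega>) = (\<Sum>t\<in>D. a t * X t \<omega>)"
      using D by (intro sum.cong) auto
    then show "(\<Sum>t\<in>insert s D. (a(s := u)) t * X t \<omega>) = u * X s \<omega> + (\<Sum>t\<in>D. a t * X t \<omega>)"
      using D by simp
    have "(\<Sum>t\<in>D. ((\<lambda>t. - a t)(s := u)) t * X t \<omega>) = (\<Sum>t\<in>D. - a t * X t \<omega>)"
      using D by (intro sum.cong) auto
    then show "(\<Sum>t\<in>insert s D. ((\<lambda>t. - a t)(s := u)) t * X t \<omega>) = u * X s \<omega> - (\<Sum>t\<in>D. a t * X t \<omega>)"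
      using D by (simp add: sum_negf)
  qed
  have cos: "complex_of_real (cos r) = (iexp r + iexp (- r)) / 2" for r
    by (simp add: cos_exp_eq cos_of_real[symmetric] del: cos_of_real)
  have point: "of_real (p * (1 + cos (c + r))) * iexp x =
    of_real p * iexp x + (iexp c * (of_real p * iexp (x + r)) + iexp (- c) * (of_real p * iexp (x - r))) / 2" for p r x
    by (simp add: cos exp_add exp_diff exp_minus field_simps)
  have int: "integrable M (\<lambda>\<omega>. of_real (\<Prod>t\<in>A. indicator (B t) (X t \<omega>)) * iexp (\<Sum>t\<in>F. b t * X t \<omega>))"
    if "F \<subseteq> insert s D" for F b
    by (rule integrable_mixed_chf[OF assms(1)]) (use X B that in auto)
  note ints = int[of "{s}" "\<lambda>_. u"] int[of "insert s D" "a(s := u)"] int[of "insert s D" "(\<lambda>t. - a t)(s := u)"]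
  show ?thesis
    using ints unfolding mixed_chf_def point sums
    by (simp add: Bochner_Integration.integral_add Bochner_Integration.integrable_add del: of_real_add of_real_mult of_real_diff of_real_prod)
qed


text \<open>The real and imaginary parts of iexp R are cos R and cos (R - pi / 2), whence the phases
  0 and - pi / 2. The weights only offer 1 + cos, so the constant part is subtracted; it is half of
  \<open>W 0 (\<lambda>_. 0)\<close>, where the weight is constantly 2.\<close>

lemma mixed_chf_insert:
  assumes "prob_space M" and A: "finite A" "s \<notin> A" and X: "\<And>t. t \<in> insert s A \<union> D \<Longrightarrow> X t \<in> borel_measurable M"
    and B: "\<And>t. t \<in> insert s A \<Longrightarrow> B t \<in> sets borel"
  defines "W \<equiv> \<lambda>c a. (LINT \<omega>|M. (\<Prod>t\<in>A. indicator (B t) (X t \<omega>)) * (1 + cos (c + (\<Sum>t\<in>D. a t * X t \<omega>))) *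
    indicator (B s) (X s \<omega>))"
  shows "mixed_chf M X B (insert s A) D a =
    of_real (W 0 a - W 0 (\<lambda>_. 0) / 2) + \<i> * of_real (W (- pi / 2) a - W 0 (\<lambda>_. 0) / 2)"
proof -
  interpret prob_space M by fact
  define P where "P \<omega> = (\<Prod>t\<in>insert s A. indicator (B t) (X t \<omega>) :: real)" for \<omega>
  define R where "R a \<omega> = (\<Sum>t\<in>D. a t * X t \<omega>)" for a \<omega>
  have P: "P \<omega> = (\<Prod>t\<in>A. indicator (B t) (X t \<omega>)) * indicator (B s) (X s \<omega>)" for \<omega>
    using A by (simp add: P_def)
  have [measurable]: "P \<in> borel_measurable M"
    unfolding P_def using X B by (intro borel_measurable_prod measurable_compose[OF _ borel_measurable_indicator]) auto
  have [measurable]: "R a \<in> borel_measurable M" for a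
    unfolding R_def using X by (intro borel_measurable_sum borel_measurable_times) auto
  have P01: "0 \<le> P \<omega>" "P \<omega> \<le> 1" for \<omega>
    unfolding P_def by (rule prod_indicator_bounds)+
  have intP: "integrable M P"
    by (rule integrable_const_bound[where B=1]) (use P01 in auto)
  have int: "integrable M (\<lambda>\<omega>. P \<omega> * cos (c + R a \<omega>))" for c a
    by (rule integrable_const_bound[where B=1]) (use P01 in \<open>auto simp: abs_mult intro!: mult_le_one\<close>)
  have W: "W c a = (LINT \<omega>|M. P \<omega>) + (LINT \<omega>|M. P \<omega> * cos (c + R a \<omega>))" for c a
  proof -
    have "W c a = (LINT \<omega>|M. P \<omega> + P \<omega> * cos (c + R a \<omega>))"
      unfolding W_def P R_def by (intro Bochner_Integration.integral_cong) (auto simp: algebra_simps)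
    then show ?thesis
      using intP int by simp
  qed
  have "W 0 (\<lambda>_. 0) = 2 * (LINT \<omega>|M. P \<omega>)"
    unfolding W by (simp add: R_def)
  then have WW: "(LINT \<omega>|M. P \<omega> * cos (c + R a \<omega>)) = W c a - W 0 (\<lambda>_. 0) / 2" for c
    unfolding W[of c a] by simp
  have "mixed_chf M X B (insert s A) D a =
    (CLINT \<omega>|M. of_real (P \<omega> * cos (0 + R a \<omega>)) + \<i> * of_real (P \<omega> * cos (- pi / 2 + R a \<omega>)))"
    unfolding mixed_chf_def P_def[symmetric] R_def[symmetric]
    by (intro Bochner_Integration.integral_cong)
       (auto simp: cis_conv_exp[symmetric] complex_eq_iff cos_add cos_diff simp flip: cos_minus[of "_ - pi / 2"])
  also have "\<dots> = of_real (LINT \<omega>|M. P \<omega> * cos (0 + R a \<omega>)) + \<i> * of_real (LINT \<omega>|M. P \<omega> * cos (- pi / 2 + R a \<omega>))"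
    using int[of 0 a] int[of "- pi / 2" a]
    by (subst Bochner_Integration.integral_add) (auto simp del: of_real_mult simp add: integral_complex_of_real)
  finally show ?thesis
    unfolding WW .
qed

text \<open>Induction on A with D and a arbitrary: turning the exponential in coordinate s into an
  indicator calls the induction hypothesis with s among the exponential coordinates, once alone and
  once together with D under changed coefficients.\<close>

lemma mixed_chf_eq_if_chf_eq:
  assumes M: "prob_space M" and N: "prob_space N"
    and X: "\<And>t. t \<in> T \<Longrightarrow> X t \<in> borel_measurable M" and Y: "\<And>t. t \<in> T \<Longrightarrow> Y t \<in> borel_measurable N"
    and B: "\<And>t. t \<in> T \<Longrightarrow> B t \<in> sets borel"
    and chf: "\<And>D a. finite D \<Longrightarrow> D \<subseteq> T \<Longrightarrow>
      (CLINT \<omega>|M. iexp (\<Sum>t\<in>D. a t * X t \<omega>)) = (CLINT \<omega>|N. iexp (\<Sum>t\<in>D. a t * Y t \<omega>))"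
    and "finite A" "A \<subseteq> T" "finite D" "D \<subseteq> T" "A \<inter> D = {}"
  shows "mixed_chf M X B A D a = mixed_chf N Y B A D a"
  using assms(7-11)
proof (induction A arbitrary: D a rule: finite_induct)
  case empty
  then show ?case
    using chf[of D a] by (simp add: mixed_chf_def)
next
  case (insert s A)
  have law: "(LINT \<omega>|M. (\<Prod>t\<in>A. indicator (B t) (X t \<omega>)) * (1 + cos (c + (\<Sum>t\<in>D. a t * X t \<omega>))) * indicator (B s) (X s \<omega>)) =
    (LINT \<omega>|N. (\<Prod>t\<in>A. indicator (B t) (Y t \<omega>)) * (1 + cos (c + (\<Sum>t\<in>D. a t * Y t \<omega>))) * indicator (B s) (Y s \<omega>))" for c a
  proof (rule weighted_law_eq_if_chf_eq[OF M N])
    have "mixed_chf M X B A {s} (\<lambda>_. u) = mixed_chf N Y B A {s} (\<lambda>_. u)" for u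
      using insert by (intro insert.IH) auto
    moreover have "mixed_chf M X B A (insert s D) b = mixed_chf N Y B A (insert s D) b" for b
      using insert by (intro insert.IH) auto
    ultimately show "(CLINT \<omega>|M. of_real ((\<Prod>t\<in>A. indicator (B t) (X t \<omega>)) * (1 + cos (c + (\<Sum>t\<in>D. a t * X t \<omega>)))) * iexp (u * X s \<omega>)) =
      (CLINT \<omega>|N. of_real ((\<Prod>t\<in>A. indicator (B t) (Y t \<omega>)) * (1 + cos (c + (\<Sum>t\<in>D. a t * Y t \<omega>)))) * iexp (u * Y s \<omega>))" for u
      using insert.prems insert.hyps X Y B
      by (subst (1 2) chf_cos_weight) (auto simp: M N)
    have bound: "0 \<le> p * (1 + cos r) \<and> p * (1 + cos r) \<le> 2" if "0 \<le> p" "p \<le> 1" for p r :: real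
    proof -
      have "0 \<le> 1 + cos r" "1 + cos r \<le> 2"
        using cos_ge_minus_one[of r] cos_le_one[of r] by linarith+
      then show ?thesis
        using that mult_mono[of p 1 "1 + cos r" 2] by simp
    qed
    show "0 \<le> (\<Prod>t\<in>A. indicator (B t) (X t \<omega>)) * (1 + cos (c + (\<Sum>t\<in>D. a t * X t \<omega>))) \<and>
      (\<Prod>t\<in>A. indicator (B t) (X t \<omega>)) * (1 + cos (c + (\<Sum>t\<in>D. a t * X t \<omega>))) \<le> 2" for \<omega>
      by (intro bound prod_indicator_bounds)
    show "0 \<le> (\<Prod>t\<in>A. indicator (B t) (Y t \<omega>)) * (1 + cos (c + (\<Sum>t\<in>D. a t * Y t \<omega>))) \<and>
      (\<Prod>t\<in>A. indicator (B t) (Y t \<omega>)) * (1 + cos (c + (\<Sum>t\<in>D. a t * Y t \<omega>))) \<le> 2" for \<omega>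
      by (intro bound prod_indicator_bounds)
    have s: "s \<in> T" and DT: "D \<subseteq> T" and AT: "A \<subseteq> T"
      using insert.prems by auto
    show "X s \<in> borel_measurable M" "Y s \<in> borel_measurable N" "B s \<in> sets borel"
      using X Y B s by auto
    have [measurable]: "(\<lambda>\<omega>. \<Sum>t\<in>D. a t * X t \<omega>) \<in> borel_measurable M" "(\<lambda>\<omega>. \<Sum>t\<in>D. a t * Y t \<omega>) \<in> borel_measurable N"
      using X Y DT by (auto intro!: borel_measurable_sum borel_measurable_times)
    have [measurable]: "(\<lambda>\<omega>. \<Prod>t\<in>A. indicator (B t) (X t \<omega>) :: real) \<in> borel_measurable M"
      "(\<lambda>\<omega>. \<Prod>t\<in>A. indicator (B t) (Y t \<omega>) :: real) \<in> borel_measurable N"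
      using X Y B AT by (auto intro!: borel_measurable_prod measurable_compose[OF _ borel_measurable_indicator])
    show "(\<lambda>\<omega>. (\<Prod>t\<in>A. indicator (B t) (X t \<omega>)) * (1 + cos (c + (\<Sum>t\<in>D. a t * X t \<omega>)))) \<in> borel_measurable M"
      by measurable
    show "(\<lambda>\<omega>. (\<Prod>t\<in>A. indicator (B t) (Y t \<omega>)) * (1 + cos (c + (\<Sum>t\<in>D. a t * Y t \<omega>)))) \<in> borel_measurable N"
      by measurable
  qed
  have *: "\<And>t. t \<in> insert s A \<union> D \<Longrightarrow> t \<in> T"
    using insert.prems by auto
  show ?case
    using M N X Y B * by (subst (1 2) mixed_chf_insert[OF _ insert.hyps]; ((simp only: law; fail) | blast))
qed

text \<open>With indicators on all of J and no exponentials left, \<open>mixed_chf\<close> is the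
  probability of a box, and boxes determine a finite measure on the product. The real part only
  undoes the embedding into the complex numbers.\<close>

theorem distr_eq_if_chf_eq:
  assumes M: "prob_space M" and N: "prob_space N" and J: "finite J"
    and X: "\<And>t. t \<in> J \<Longrightarrow> X t \<in> borel_measurable M" and Y: "\<And>t. t \<in> J \<Longrightarrow> Y t \<in> borel_measurable N"
    and chf: "\<And>D a. finite D \<Longrightarrow> D \<subseteq> J \<Longrightarrow>
      (CLINT \<omega>|M. iexp (\<Sum>t\<in>D. a t * X t \<omega>)) = (CLINT \<omega>|N. iexp (\<Sum>t\<in>D. a t * Y t \<omega>))"
  shows "distr M (\<Pi>\<^sub>M t\<in>J. (borel :: real measure)) (\<lambda>\<omega>. \<lambda>t\<in>J. X t \<omega>) =
    distr N (\<Pi>\<^sub>M t\<in>J. (borel :: real measure)) (\<lambda>\<omega>. \<lambda>t\<in>J. Y t \<omega>)"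
proof -
  interpret M: prob_space M by fact
  interpret N: prob_space N by fact
  have Xm: "(\<lambda>\<omega>. \<lambda>t\<in>J. X t \<omega>) \<in> measurable M (\<Pi>\<^sub>M t\<in>J. borel)"
    using X by (intro measurable_restrict) auto
  have Ym: "(\<lambda>\<omega>. \<lambda>t\<in>J. Y t \<omega>) \<in> measurable N (\<Pi>\<^sub>M t\<in>J. borel)"
    using Y by (intro measurable_restrict) auto
  have box: "emeasure (distr L (\<Pi>\<^sub>M t\<in>J. borel) (\<lambda>\<omega>. \<lambda>t\<in>J. Z t \<omega>)) (Pi\<^sub>E J B) = ennreal (Re (mixed_chf L Z B J {} (\<lambda>_. 0)))"
    if L: "prob_space L" and Z: "\<And>t. t \<in> J \<Longrightarrow> Z t \<in> borel_measurable L"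
      and B: "\<And>t. t \<in> J \<Longrightarrow> B t \<in> sets borel" for L :: "'x measure" and Z B
  proof -
    interpret prob_space L by fact
    let ?E = "(\<lambda>\<omega>. \<lambda>t\<in>J. Z t \<omega>) -` (Pi\<^sub>E J B) \<inter> space L"
    have Zm: "(\<lambda>\<omega>. \<lambda>t\<in>J. Z t \<omega>) \<in> measurable L (\<Pi>\<^sub>M t\<in>J. borel)"
      using Z by (intro measurable_restrict) auto
    have Bs: "Pi\<^sub>E J B \<in> sets (\<Pi>\<^sub>M t\<in>J. borel)"
      using J B by (intro sets_PiM_I_finite) auto
    have E: "?E \<in> sets L"
      using Zm Bs by (rule measurable_sets)
    have "(\<Prod>t\<in>J. indicator (B t) (Z t \<omega>) :: real) = indicator ?E \<omega>" if "\<omega> \<in> space L" for \<omega>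
    proof (cases "\<forall>t\<in>J. Z t \<omega> \<in> B t")
      case True
      then show ?thesis using that by (auto simp: indicator_def PiE_iff)
    next
      case False
      then obtain t where "t \<in> J" "indicator (B t) (Z t \<omega>) = (0 :: real)"
        by (auto simp: indicator_def)
      then have "(\<Prod>t\<in>J. indicator (B t) (Z t \<omega>) :: real) = 0"
        using J by (intro prod_zero) auto
      then show ?thesis using False by (auto simp: indicator_def PiE_iff)
    qed
    then have "mixed_chf L Z B J {} (\<lambda>_. 0) = of_real (LINT \<omega>|L. indicator ?E \<omega>)"
      unfolding mixed_chf_def integral_complex_of_real[symmetric]
      by (intro Bochner_Integration.integral_cong) (auto simp del: of_real_prod)
    then show ?thesis
      using E by (simp add: emeasure_distr[OF Zm Bs] emeasure_eq_measure)
  qed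
  show ?thesis
  proof (rule measure_eqI_PiM_finite[OF J])
    fix B :: "_ \<Rightarrow> real set" assume B: "\<And>t. t \<in> J \<Longrightarrow> B t \<in> sets borel"
    show "emeasure (distr M (\<Pi>\<^sub>M t\<in>J. borel) (\<lambda>\<omega>. \<lambda>t\<in>J. X t \<omega>)) (Pi\<^sub>E J B) =
      emeasure (distr N (\<Pi>\<^sub>M t\<in>J. borel) (\<lambda>\<omega>. \<lambda>t\<in>J. Y t \<omega>)) (Pi\<^sub>E J B)"
      using mixed_chf_eq_if_chf_eq[where T=J and X=X and Y=Y and B=B and A=J and D="{}", OF M N X Y B chf J]
      by (simp add: box[OF M X B] box[OF N Y B])
  next
    \<comment> \<open>The exhausting sequence of boxes may be constant, since the whole space is a
      box of finite mass.\<close>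
    show "range (\<lambda>_::nat. \<Pi>\<^sub>E t\<in>J. UNIV) \<subseteq> prod_algebra J (\<lambda>_. borel :: real measure)"
      using J by (auto intro!: prod_algebraI_finite)
    show "(\<Union>i::nat. \<Pi>\<^sub>E t\<in>J. UNIV) = space (\<Pi>\<^sub>M t\<in>J. (borel :: real measure))"
      by (simp add: space_PiM)
    show "emeasure (distr M (\<Pi>\<^sub>M t\<in>J. borel) (\<lambda>\<omega>. \<lambda>t\<in>J. X t \<omega>)) (\<Pi>\<^sub>E t\<in>J. UNIV) \<noteq> \<infinity>" for i :: nat
      using finite_measure.emeasure_finite[OF M.finite_measure_distr[OF Xm]] by simp
  qed simp_all
qed

lemma same_distribution_if_gaussian_family:
  assumes X: "gaussian_family M {0..} X C" and Y: "gaussian_family N {0..} Y C"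
  shows "same_distribution M X N Y"
  unfolding same_distribution_def
proof (intro allI impI)
  fix J :: "real set" assume J: "finite J" "J \<subseteq> {0..}"
  show "distr M (\<Pi>\<^sub>M t\<in>J. (borel :: real measure)) (\<lambda>\<omega>. \<lambda>t\<in>J. X t \<omega>) =
    distr N (\<Pi>\<^sub>M t\<in>J. (borel :: real measure)) (\<lambda>\<omega>. \<lambda>t\<in>J. Y t \<omega>)"
  proof (rule distr_eq_if_chf_eq[OF gaussian_family_prob_space[OF X] gaussian_family_prob_space[OF Y] J(1)])
    show "X t \<in> borel_measurable M" "Y t \<in> borel_measurable N" if "t \<in> J" for t
      using that J gaussian_family_measurable[OF X] gaussian_family_measurable[OF Y] by auto
    show "(CLINT \<omega>|M. iexp (\<Sum>t\<in>D. a t * X t \<omega>)) = (CLINT \<omega>|N. iexp (\<Sum>t\<in>D. a t * Y t \<omega>))"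
      if D: "finite D" "D \<subseteq> J" for D a
    proof -
      from D J have "D \<subseteq> {0..}" by auto
      then show ?thesis
        using D gaussian_family_chf[OF X] gaussian_family_chf[OF Y] by simp
    qed
  qed
qed

subsection \<open>Closure properties of Gaussian families\<close>

text \<open>\<open>gaussian_family\<close> speaks of finite sets of times, whereas Riemann sums at
  several endpoints can use the same time repeatedly. Collecting the coefficients over each fibre of
  \<tau> merges such repetitions.\<close>

definition preimage_weight :: "'i set \<Rightarrow> ('i \<Rightarrow> 'j) \<Rightarrow> ('i \<Rightarrow> real) \<Rightarrow> 'j \<Rightarrow> real" where
  "preimage_weight I \<tau> a t = (\<Sum>i | i \<in> I \<and> \<tau> i = t. a i)"

lemma sum_preimage_weight:
  fixes f :: "'j \<Rightarrow> real"
  assumes "finite I"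
  shows "(\<Sum>i\<in>I. a i * f (\<tau> i)) = (\<Sum>t\<in>\<tau> ` I. preimage_weight I \<tau> a t * f t)"
proof -
  have "(\<Sum>i\<in>I. a i * f (\<tau> i)) = (\<Sum>t\<in>\<tau> ` I. \<Sum>i | i \<in> I \<and> \<tau> i = t. a i * f (\<tau> i))"
    using assms by (subst sum.group) auto
  also have "\<dots> = (\<Sum>t\<in>\<tau> ` I. preimage_weight I \<tau> a t * f t)"
    by (intro sum.cong) (auto simp: preimage_weight_def sum_distrib_right)
  finally show ?thesis .
qed

lemma quadratic_form_preimage_weight:
  fixes C :: "'j \<Rightarrow> 'j \<Rightarrow> real"
  assumes "finite I"
  shows "(\<Sum>i\<in>I. \<Sum>j\<in>I. a i * a j * C (\<tau> i) (\<tau> j)) =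
    (\<Sum>s\<in>\<tau> ` I. \<Sum>t\<in>\<tau> ` I. preimage_weight I \<tau> a s * preimage_weight I \<tau> a t * C s t)"
proof -
  have "(\<Sum>i\<in>I. \<Sum>j\<in>I. a i * a j * C (\<tau> i) (\<tau> j)) = (\<Sum>i\<in>I. a i * (\<Sum>j\<in>I. a j * C (\<tau> i) (\<tau> j)))"
    by (simp add: sum_distrib_left mult.assoc)
  also have "\<dots> = (\<Sum>i\<in>I. a i * (\<Sum>t\<in>\<tau> ` I. preimage_weight I \<tau> a t * C (\<tau> i) t))"
    using sum_preimage_weight[OF assms, where f="C (\<tau> i)" and a=a for i] by simp
  also have "\<dots> = (\<Sum>s\<in>\<tau> ` I. preimage_weight I \<tau> a s * (\<Sum>t\<in>\<tau> ` I. preimage_weight I \<tau> a t * C s t))"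
    by (rule sum_preimage_weight[OF assms])
  finally show ?thesis
    by (simp add: sum_distrib_left mult.assoc)
qed

lemma gaussian_family_chf_indexed:
  assumes G: "gaussian_family M T X C" and I: "finite I" "\<tau> ` I \<subseteq> T"
  shows "(CLINT \<omega>|M. iexp (\<Sum>i\<in>I. a i * X (\<tau> i) \<omega>)) =
    of_real (exp (- (\<Sum>i\<in>I. \<Sum>j\<in>I. a i * a j * C (\<tau> i) (\<tau> j)) / 2))"
  unfolding quadratic_form_preimage_weight[OF I(1)] sum_preimage_weight[OF I(1), where f="\<lambda>t. X t \<omega>" for \<omega>]
  by (rule gaussian_family_chf[OF G _ I(2)]) (use I in simp)

text \<open>A combination of combinations is flattened to a sum over pairs in
  \<open>Sigma I J\<close>; the indexed form of the characteristic function then allows coinciding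
  times.\<close>

lemma gaussian_family_linear:
  fixes J :: "'i \<Rightarrow> 'j set"
  assumes G: "gaussian_family M T X C"
    and J: "\<And>i. i \<in> S \<Longrightarrow> finite (J i)" "\<And>i j. i \<in> S \<Longrightarrow> j \<in> J i \<Longrightarrow> \<tau> i j \<in> T"
  shows "gaussian_family M S (\<lambda>i \<omega>. \<Sum>j\<in>J i. b i j * X (\<tau> i j) \<omega>)
    (\<lambda>i i'. \<Sum>j\<in>J i. \<Sum>j'\<in>J i'. b i j * b i' j' * C (\<tau> i j) (\<tau> i' j'))"
  unfolding gaussian_family_def
proof (intro conjI ballI allI impI)
  show "prob_space M"
    by (rule gaussian_family_prob_space[OF G])
  show "(\<lambda>\<omega>. \<Sum>j\<in>J i. b i j * X (\<tau> i j) \<omega>) \<in> borel_measurable M" if "i \<in> S" for i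
    using that J gaussian_family_measurable[OF G] by (intro borel_measurable_sum borel_measurable_times) auto
  fix I and a :: "'i \<Rightarrow> real"
  assume I: "finite I" "I \<subseteq> S"
  have fin: "\<And>i. i \<in> I \<Longrightarrow> finite (J i)"
    using I J by auto
  have sigma: "(\<Sum>i\<in>I. a i * (\<Sum>j\<in>J i. f i j)) = (\<Sum>p\<in>Sigma I J. a (fst p) * f (fst p) (snd p))"
    for f :: "'i \<Rightarrow> 'j \<Rightarrow> real"
    using I fin by (simp add: sum_distrib_left sum.Sigma split_def)
  have "(\<Sum>i\<in>I. \<Sum>i'\<in>I. a i * a i' * (\<Sum>j\<in>J i. \<Sum>j'\<in>J i'. b i j * b i' j' * C (\<tau> i j) (\<tau> i' j'))) =
    (\<Sum>i\<in>I. a i * (\<Sum>j\<in>J i. \<Sum>i'\<in>I. a i' * (\<Sum>j'\<in>J i'. b i j * b i' j' * C (\<tau> i j) (\<tau> i' j'))))"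
    by (simp add: sum_distrib_left mult.assoc)
       (intro sum.cong refl, rule sum.swap)
  also have "\<dots> = (\<Sum>p\<in>Sigma I J. a (fst p) * (\<Sum>q\<in>Sigma I J. a (fst q) *
     (b (fst p) (snd p) * b (fst q) (snd q) * C (\<tau> (fst p) (snd p)) (\<tau> (fst q) (snd q)))))"
    by (simp only: sigma)
  also have "\<dots> = (\<Sum>p\<in>Sigma I J. \<Sum>q\<in>Sigma I J. (a (fst p) * b (fst p) (snd p)) * (a (fst q) * b (fst q) (snd q)) *
      C (\<tau> (fst p) (snd p)) (\<tau> (fst q) (snd q)))"
    by (simp add: sum_distrib_left mult_ac)
  finally have cov: "(\<Sum>i\<in>I. \<Sum>i'\<in>I. a i * a i' * (\<Sum>j\<in>J i. \<Sum>j'\<in>J i'. b i j * b i' j' * C (\<tau> i j) (\<tau> i' j'))) = \<dots>" .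
  have lin: "(\<Sum>i\<in>I. a i * (\<Sum>j\<in>J i. b i j * X (\<tau> i j) \<omega>)) =
    (\<Sum>p\<in>Sigma I J. (a (fst p) * b (fst p) (snd p)) * X (\<tau> (fst p) (snd p)) \<omega>)" for \<omega>
    by (simp only: sigma mult.assoc)
  show "(CLINT \<omega>|M. iexp (\<Sum>i\<in>I. a i * (\<Sum>j\<in>J i. b i j * X (\<tau> i j) \<omega>))) =
    of_real (exp (- (\<Sum>i\<in>I. \<Sum>i'\<in>I. a i * a i' * (\<Sum>j\<in>J i. \<Sum>j'\<in>J i'. b i j * b i' j' * C (\<tau> i j) (\<tau> i' j'))) / 2))"
    unfolding cov lin
    by (rule gaussian_family_chf_indexed[OF G, where \<tau>="\<lambda>p. \<tau> (fst p) (snd p)" and a="\<lambda>p. a (fst p) * b (fst p) (snd p)"])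
       (use I J fin in auto)
qed

lemma gaussian_family_reindex:
  assumes "gaussian_family M T X C" and "\<tau> ` S \<subseteq> T"
  shows "gaussian_family M S (\<lambda>i. X (\<tau> i)) (\<lambda>i j. C (\<tau> i) (\<tau> j))"
  using gaussian_family_linear[OF assms(1), of S "\<lambda>_. {()}" "\<lambda>i _. \<tau> i" "\<lambda>_ _. 1"] assms(2) by auto

lemma gaussian_family_cov_cong:
  assumes "gaussian_family M T X C" and "\<And>s t. s \<in> T \<Longrightarrow> t \<in> T \<Longrightarrow> C s t = C' s t"
  shows "gaussian_family M T X C'"
proof -
  have "(\<Sum>s\<in>J. \<Sum>t\<in>J. a s * a t * C s t) = (\<Sum>s\<in>J. \<Sum>t\<in>J. a s * a t * C' s t)"
    if "J \<subseteq> T" for J and a :: "'b \<Rightarrow> real"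
    using that assms(2) by (intro sum.cong) auto
  then show ?thesis
    using assms(1) by (simp add: gaussian_family_def)
qed

text \<open>Characters have modulus 1, so dominated convergence carries almost sure limits through
  the characteristic functions; moments of the approximants need no control beyond the convergence
  of the covariances.\<close>

lemma gaussian_family_limit:
  assumes Y: "\<And>n. gaussian_family M T (Y n) (C n)"
    and X: "\<And>t. t \<in> T \<Longrightarrow> X t \<in> borel_measurable M"
    and lim: "\<And>t. t \<in> T \<Longrightarrow> AE \<omega> in M. (\<lambda>n. Y n t \<omega>) \<longlonglongrightarrow> X t \<omega>"
    and cov: "\<And>s t. s \<in> T \<Longrightarrow> t \<in> T \<Longrightarrow> (\<lambda>n. C n s t) \<longlonglongrightarrow> D s t"
  shows "gaussian_family M T X D"
  unfolding gaussian_family_def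
proof (intro conjI ballI allI impI)
  interpret prob_space M
    by (rule gaussian_family_prob_space[OF Y])
  show "prob_space M" by (rule prob_space_axioms)
  show "X t \<in> borel_measurable M" if "t \<in> T" for t
    using X that .
  fix J and a :: "'b \<Rightarrow> real" assume J: "finite J" "J \<subseteq> T"
  have "(\<lambda>n. CLINT \<omega>|M. iexp (\<Sum>t\<in>J. a t * Y n t \<omega>)) \<longlonglongrightarrow> (CLINT \<omega>|M. iexp (\<Sum>t\<in>J. a t * X t \<omega>))"
  proof (rule integral_dominated_convergence[where w="\<lambda>_. 1"])
    have "(\<lambda>\<omega>. \<Sum>t\<in>J. a t * X t \<omega>) \<in> borel_measurable M" "(\<lambda>\<omega>. \<Sum>t\<in>J. a t * Y n t \<omega>) \<in> borel_measurable M" for n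
      using J X gaussian_family_measurable[OF Y] by (auto intro!: borel_measurable_sum borel_measurable_times)
    note [measurable] = this
    show "(\<lambda>\<omega>. iexp (\<Sum>t\<in>J. a t * X t \<omega>)) \<in> borel_measurable M"
      "(\<lambda>\<omega>. iexp (\<Sum>t\<in>J. a t * Y n t \<omega>)) \<in> borel_measurable M" for n
      by measurable
    have "AE \<omega> in M. \<forall>t\<in>J. (\<lambda>n. Y n t \<omega>) \<longlonglongrightarrow> X t \<omega>"
      using J lim by (intro AE_finite_allI) auto
    then show "AE \<omega> in M. (\<lambda>n. iexp (\<Sum>t\<in>J. a t * Y n t \<omega>)) \<longlonglongrightarrow> iexp (\<Sum>t\<in>J. a t * X t \<omega>)"
      by eventually_elim (intro tendsto_intros; auto)
  qed (auto simp del: of_real_sum)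
  moreover have "(\<lambda>n. complex_of_real (exp (- (\<Sum>s\<in>J. \<Sum>t\<in>J. a s * a t * C n s t) / 2))) \<longlonglongrightarrow>
    of_real (exp (- (\<Sum>s\<in>J. \<Sum>t\<in>J. a s * a t * D s t) / 2))"
    using J cov by (intro tendsto_intros) auto
  ultimately show "(CLINT \<omega>|M. iexp (\<Sum>t\<in>J. a t * X t \<omega>)) =
      of_real (exp (- (\<Sum>s\<in>J. \<Sum>t\<in>J. a s * a t * D s t) / 2))"
    using J by (simp only: gaussian_family_chf[OF Y] LIMSEQ_unique)
qed

subsection \<open>Existence of Gaussian families on countable index sets\<close>

text \<open>The index type \<open>real\<close> gives the points the type
  \<open>real \<Rightarrow> real\<close>, the sample type of the existence claims. The construction
  below reads the coordinates \<open>real k\<close> for natural k.\<close>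

abbreviation white_noise :: "(real \<Rightarrow> real) measure" where
  "white_noise \<equiv> \<Pi>\<^sub>M _\<in>UNIV. std_normal_distribution"

text \<open>The joint law of the coordinates is the product of their laws, which is independence;
  hence the characteristic function of a sum factors.\<close>

lemma gaussian_family_white_noise:
  "gaussian_family white_noise UNIV (\<lambda>t \<omega>. \<omega> t) (\<lambda>s t. if s = t then 1 else 0)"
  unfolding gaussian_family_def
proof (intro conjI ballI allI impI)
  interpret S: prob_space std_normal_distribution by (rule prob_space_std_normal)
  interpret P: product_prob_space "\<lambda>_::real. std_normal_distribution" UNIV ..
  show "prob_space white_noise"
    by (intro prob_space_PiM prob_space_std_normal)
  show meas: "(\<lambda>\<omega>. \<omega> t) \<in> borel_measurable white_noise" for t
  proof -
    have "(\<lambda>\<omega>. \<omega> t) \<in> measurable white_noise std_normal_distribution"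
      by (rule measurable_component_singleton) simp
    then show ?thesis by simp
  qed
  fix J :: "real set" and a :: "real \<Rightarrow> real" assume J: "finite J"
  have distr_coord: "distr white_noise borel (\<lambda>\<omega>. \<omega> t) = std_normal_distribution" for t
  proof -
    have "distr white_noise borel (\<lambda>\<omega>. \<omega> t) = distr white_noise std_normal_distribution (\<lambda>\<omega>. \<omega> t)"
      by (rule distr_cong) simp_all
    also have "\<dots> = std_normal_distribution"
      by (rule distr_PiM_component) (simp_all add: prob_space_std_normal)
    finally show ?thesis .
  qed
  have sets: "sets (\<Pi>\<^sub>M _\<in>UNIV. borel) = sets white_noise"
    by (intro sets_PiM_cong) simp_all
  have "P.indep_vars (\<lambda>_. borel) (\<lambda>t \<omega>. \<omega> t) UNIV"
  proof (subst P.indep_vars_iff_distr_eq_PiM)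
    show "distr white_noise (\<Pi>\<^sub>M t\<in>UNIV. borel) (\<lambda>\<omega>. \<lambda>t\<in>UNIV. \<omega> t) =
      (\<Pi>\<^sub>M t\<in>UNIV. distr white_noise borel (\<lambda>\<omega>. \<omega> t))"
      unfolding distr_coord restrict_UNIV by (rule distr_id2[OF sets])
  qed (use meas in auto)
  then have "P.indep_vars (\<lambda>_. borel) (\<lambda>t \<omega>. \<omega> t) J"
    by (rule P.indep_vars_subset) simp
  then have ind: "P.indep_vars (\<lambda>_. borel) (\<lambda>t \<omega>. a t * \<omega> t) J"
    by (rule P.indep_vars_compose2) simp
  have char1: "char (distr white_noise borel (\<lambda>\<omega>. a t * \<omega> t)) 1 = of_real (exp (- (a t)\<^sup>2 / 2))" for t
  proof -
    have "char (distr white_noise borel (\<lambda>\<omega>. a t * \<omega> t)) 1 = char (distr white_noise borel (\<lambda>\<omega>. \<omega> t)) (a t)"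
      unfolding char_def using meas by (subst (1 2) integral_distr) auto
    then show ?thesis
      by (simp only: distr_coord char_std_normal_distribution)
  qed
  have "(CLINT \<omega>|white_noise. iexp (\<Sum>t\<in>J. a t * \<omega> t)) = char (distr white_noise borel (\<lambda>\<omega>. \<Sum>t\<in>J. a t * \<omega> t)) 1"
    unfolding char_def using meas by (subst integral_distr) (auto intro!: borel_measurable_sum borel_measurable_times)
  also have "\<dots> = (\<Prod>t\<in>J. of_real (exp (- (a t)\<^sup>2 / 2)))"
    unfolding P.char_distr_sum[OF ind] char1 ..
  also have "\<dots> = of_real (exp (\<Sum>t\<in>J. - (a t)\<^sup>2 / 2))"
    using J by (simp add: exp_sum)
  also have "(\<Sum>t\<in>J. - (a t)\<^sup>2 / 2) = - (\<Sum>s\<in>J. \<Sum>t\<in>J. a s * a t * (if s = t then 1 else 0)) / 2"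
    using J by (simp add: sum_divide_distrib sum_negf power2_eq_square if_distrib[of "\<lambda>x. _ * x"] cong: if_cong)
  finally show "(CLINT \<omega>|white_noise. iexp (\<Sum>t\<in>J. a t * \<omega> t)) =
    of_real (exp (- (\<Sum>s\<in>J. \<Sum>t\<in>J. a s * a t * (if s = t then 1 else 0)) / 2))" .
qed


section \<open>Positive semidefinite kernels and Cholesky factorisation\<close>

definition pos_semidef :: "'i set \<Rightarrow> ('i \<Rightarrow> 'i \<Rightarrow> real) \<Rightarrow> bool" where
  "pos_semidef T C \<longleftrightarrow> (\<forall>s\<in>T. \<forall>t\<in>T. C s t = C t s) \<and>
     (\<forall>J a. finite J \<longrightarrow> J \<subseteq> T \<longrightarrow> 0 \<le> (\<Sum>s\<in>J. \<Sum>t\<in>J. a s * a t * C s t))"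

lemma pos_semidef_sym: "pos_semidef T C \<Longrightarrow> s \<in> T \<Longrightarrow> t \<in> T \<Longrightarrow> C s t = C t s"
  and pos_semidef_nonneg: "pos_semidef T C \<Longrightarrow> finite J \<Longrightarrow> J \<subseteq> T \<Longrightarrow> 0 \<le> (\<Sum>s\<in>J. \<Sum>t\<in>J. a s * a t * C s t)"
  by (auto simp: pos_semidef_def)

lemma pos_semidef_diag: "pos_semidef T C \<Longrightarrow> t \<in> T \<Longrightarrow> 0 \<le> C t t"
  using pos_semidef_nonneg[of T C "{t}" "\<lambda>_. 1"] by simp

lemma pos_semidef_subset:
  assumes "pos_semidef T C" and "S \<subseteq> T"
  shows "pos_semidef S C"
  unfolding pos_semidef_def
proof (intro conjI ballI allI impI)
  show "C s t = C t s" if "s \<in> S" "t \<in> S" for s t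
    using pos_semidef_sym[OF assms(1)] that assms(2) by blast
  show "0 \<le> (\<Sum>s\<in>J. \<Sum>t\<in>J. a s * a t * C s t)" if "finite J" "J \<subseteq> S" for J a
    using pos_semidef_nonneg[OF assms(1) that(1)] that(2) assms(2) by blast
qed

text \<open>On the pair s, n with coefficients 1, x the form is C s s + 2 x C s n, affine in x, so
  it stays nonnegative only if the slope vanishes. The x chosen in the proof would give it the value
  -1.\<close>

lemma pos_semidef_zero_pivot:
  assumes "pos_semidef UNIV C" and "C n n = 0"
  shows "C s n = 0"
proof (rule ccontr)
  assume nz: "C s n \<noteq> 0"
  then have "s \<noteq> n" using assms(2) by auto
  then have "0 \<le> C s s + 2 * x * C s n" for x
    using pos_semidef_nonneg[OF assms(1), of "{s, n}" "\<lambda>t. if t = s then 1 else x"] assms(2)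
      pos_semidef_sym[OF assms(1), of n s] by (simp add: algebra_simps)
  from this[of "- (C s s + 1) / (2 * C s n)"] show False
    using nz by (simp add: field_simps)
qed

text \<open>Completing the square: the form of the complement at a is the form of C at a with x
  subtracted from the coefficient of n, where x = L / C n n. For C n n = 0, division by zero returns
  C itself.\<close>

lemma pos_semidef_schur_complement:
  assumes C: "pos_semidef UNIV C"
  shows "pos_semidef UNIV (\<lambda>s t. C s t - C s n * C n t / C n n)"
proof (cases "C n n = 0")
  case True
  then show ?thesis using C by simp
next
  case False
  have sym: "C s t = C t s" for s t
    using pos_semidef_sym[OF C] by simp
  have "0 \<le> (\<Sum>s\<in>J. \<Sum>t\<in>J. a s * a t * (C s t - C s n * C n t / C n n))" if J: "finite J" for J a
  proof -
    \<comment> \<open>The index n may lie outside J, so a is extended by 0 to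
      \<open>insert n J\<close> before its coefficient at n is changed.\<close>
    define b where "b t = (if t \<in> J then a t else 0)" for t
    define L where "L = (\<Sum>s\<in>J. a s * C s n)"
    define x where "x = L / C n n"
    let ?K = "insert n J"
    have bJ: "(\<Sum>t\<in>?K. b t * f t) = (\<Sum>t\<in>J. a t * f t)" for f
      using J by (intro sum.mono_neutral_cong_right) (auto simp: b_def)
    have row: "(\<Sum>t\<in>?K. (b t - (if t = n then x else 0)) * f t) = (\<Sum>t\<in>J. a t * f t) - x * f n" for f
    proof -
      have "(\<Sum>t\<in>?K. (b t - (if t = n then x else 0)) * f t) = (\<Sum>t\<in>?K. b t * f t) - (\<Sum>t\<in>?K. if t = n then x * f t else 0)"
        unfolding sum_subtractf[symmetric] by (intro sum.cong) (auto simp: algebra_simps)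
      then show ?thesis
        using J bJ by simp
    qed
    have "0 \<le> (\<Sum>s\<in>?K. \<Sum>t\<in>?K. (b s - (if s = n then x else 0)) * (b t - (if t = n then x else 0)) * C s t)"
      by (rule pos_semidef_nonneg[OF C]) (use J in auto)
    also have "\<dots> = (\<Sum>s\<in>?K. (b s - (if s = n then x else 0)) * (\<Sum>t\<in>?K. (b t - (if t = n then x else 0)) * C s t))"
      by (simp only: sum_distrib_left mult.assoc)
    also have "\<dots> = (\<Sum>s\<in>J. a s * ((\<Sum>t\<in>J. a t * C s t) - x * C s n)) - x * ((\<Sum>t\<in>J. a t * C n t) - x * C n n)"
      by (simp only: row)
    also have "(\<Sum>t\<in>J. a t * C n t) = L"
      by (simp add: L_def sym[of n])
    also have "(\<Sum>s\<in>J. a s * ((\<Sum>t\<in>J. a t * C s t) - x * C s n)) = (\<Sum>s\<in>J. a s * (\<Sum>t\<in>J. a t * C s t)) - x * L"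
      by (simp add: L_def algebra_simps sum_subtractf sum_distrib_left)
    also have "\<dots> - x * (L - x * C n n) = (\<Sum>s\<in>J. a s * (\<Sum>t\<in>J. a t * C s t)) - L * L / C n n"
      using False by (simp add: x_def field_simps)
    also have "L * L = (\<Sum>s\<in>J. \<Sum>t\<in>J. a s * C s n * (a t * C t n))"
      by (simp add: L_def sum_product)
    also have "(\<Sum>s\<in>J. a s * (\<Sum>t\<in>J. a t * C s t)) - (\<Sum>s\<in>J. \<Sum>t\<in>J. a s * C s n * (a t * C t n)) / C n n =
      (\<Sum>s\<in>J. \<Sum>t\<in>J. a s * a t * C s t - a s * C s n * (a t * C t n) / C n n)"
      by (simp add: sum_distrib_left sum_divide_distrib sum_subtractf mult.assoc)
    also have "\<dots> = (\<Sum>s\<in>J. \<Sum>t\<in>J. a s * a t * (C s t - C s n * C n t / C n n))"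
    proof (intro sum.cong refl)
      fix s t
      show "a s * a t * C s t - a s * C s n * (a t * C t n) / C n n = a s * a t * (C s t - C s n * C n t / C n n)"
        unfolding sym[of t n] by (simp add: algebra_simps)
    qed
    finally show ?thesis .
  qed
  then show ?thesis
    using sym by (simp add: pos_semidef_def mult.commute)
qed

text \<open>Elimination without pivoting; column \<open>n\<close> of the Cholesky factor is read off after \<open>n\<close> steps.\<close>

fun schur :: "(nat \<Rightarrow> nat \<Rightarrow> real) \<Rightarrow> nat \<Rightarrow> nat \<Rightarrow> nat \<Rightarrow> real" where
  "schur C 0 s t = C s t"
| "schur C (Suc n) s t = schur C n s t - schur C n s n * schur C n n t / schur C n n n"

definition cholesky :: "(nat \<Rightarrow> nat \<Rightarrow> real) \<Rightarrow> nat \<Rightarrow> nat \<Rightarrow> real" where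
  "cholesky C s k = schur C k s k / sqrt (schur C k k k)"

lemma pos_semidef_schur: "pos_semidef UNIV C \<Longrightarrow> pos_semidef UNIV (schur C n)"
proof (induction n)
  case 0
  then show ?case by (simp add: pos_semidef_def)
next
  case (Suc n)
  show ?case
    using pos_semidef_schur_complement[OF Suc.IH[OF Suc.prems], of n] by (simp add: pos_semidef_def)
qed

text \<open>A vanishing pivot is harmless: its row vanishes too, and \<open>x / 0 = 0\<close>.\<close>

lemma schur_eq_0:
  assumes C: "pos_semidef UNIV C" and "s < n"
  shows "schur C n s t = 0"
  using assms(2)
proof (induction n arbitrary: t)
  case (Suc n)
  have P: "pos_semidef UNIV (schur C n)"
    by (rule pos_semidef_schur[OF C])
  show ?case
  proof (cases "s = n")
    case True
    show ?thesis
      using True pos_semidef_zero_pivot[OF P, of n t] pos_semidef_sym[OF P, of n t] by (cases "schur C n n n = 0") auto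
  next
    case False
    then show ?thesis using Suc by simp
  qed
qed simp

text \<open>Each elimination step removes the rank one kernel formed by one column of the factor. By
  \<open>schur_eq_0\<close> the remainder vanishes once n exceeds s.\<close>

lemma cholesky_sum:
  assumes C: "pos_semidef UNIV C"
  shows "C s t = (\<Sum>k<n. cholesky C s k * cholesky C t k) + schur C n s t"
proof (induction n)
  case (Suc n)
  have P: "pos_semidef UNIV (schur C n)"
    by (rule pos_semidef_schur[OF C])
  have "cholesky C s n * cholesky C t n = schur C n s n * schur C n n t / schur C n n n"
    using pos_semidef_diag[OF P, of n] pos_semidef_sym[OF P, of n t] by (simp add: cholesky_def)
  then show ?case
    using Suc by simp
qed simp

lemma cholesky_eq_0: "pos_semidef UNIV C \<Longrightarrow> s < k \<Longrightarrow> cholesky C s k = 0"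
  by (simp add: cholesky_def schur_eq_0)

text \<open>The Cholesky factor is lower triangular, so each variable is a finite sum and no
  convergence question arises. An enumeration of a finite T has repetitions; positivity of D
  therefore goes through \<open>quadratic_form_preimage_weight\<close>.\<close>

lemma ex_gaussian_family_countable:
  assumes T: "countable T" "T \<noteq> {}" and C: "pos_semidef T C"
  shows "\<exists>X. gaussian_family white_noise T X C"
proof -
  define \<tau> where "\<tau> = from_nat_into T"
  define D where "D i j = C (\<tau> i) (\<tau> j)" for i j
  have \<tau>: "\<tau> i \<in> T" for i
    using T by (simp add: \<tau>_def from_nat_into)
  have D: "pos_semidef UNIV D"
    unfolding pos_semidef_def
  proof (intro conjI ballI allI impI)
    show "D i j = D j i" for i j
      using pos_semidef_sym[OF C \<tau> \<tau>] by (simp add: D_def)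
    show "0 \<le> (\<Sum>i\<in>J. \<Sum>j\<in>J. a i * a j * D i j)" if "finite J" for J a
      unfolding D_def quadratic_form_preimage_weight[OF that]
      by (rule pos_semidef_nonneg[OF C]) (use that \<tau> in auto)
  qed
  have "gaussian_family white_noise UNIV (\<lambda>i \<omega>. \<Sum>k\<in>{..i}. cholesky D i k * \<omega> (real k))
    (\<lambda>i i'. \<Sum>k\<in>{..i}. \<Sum>k'\<in>{..i'}. cholesky D i k * cholesky D i' k' * (if real k = real k' then 1 else 0))"
    by (rule gaussian_family_linear[OF gaussian_family_white_noise]) auto
  then have "gaussian_family white_noise UNIV (\<lambda>i \<omega>. \<Sum>k\<in>{..i}. cholesky D i k * \<omega> (real k)) D"
  proof (rule gaussian_family_cov_cong)
    fix i i' :: nat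
    \<comment> \<open>Only k = k' contributes. If k > i' that term is missing from the inner sum,
      but then \<open>cholesky D i' k\<close> is 0.\<close>
    have "(\<Sum>k\<in>{..i}. \<Sum>k'\<in>{..i'}. cholesky D i k * cholesky D i' k' * (if real k = real k' then 1 else 0)) =
      (\<Sum>k\<in>{..i}. cholesky D i k * cholesky D i' k)"
    proof (intro sum.cong refl)
      fix k
      have "(\<Sum>k'\<in>{..i'}. cholesky D i k * cholesky D i' k' * (if real k = real k' then 1 else 0)) =
        (\<Sum>k'\<in>{..i'}. if k = k' then cholesky D i k * cholesky D i' k' else 0)"
        by (intro sum.cong) auto
      then show "(\<Sum>k'\<in>{..i'}. cholesky D i k * cholesky D i' k' * (if real k = real k' then 1 else 0)) =
        cholesky D i k * cholesky D i' k"
        using cholesky_eq_0[OF D, of i' k] by (auto simp: sum.delta')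
    qed
    then show "(\<Sum>k\<in>{..i}. \<Sum>k'\<in>{..i'}. cholesky D i k * cholesky D i' k' * (if real k = real k' then 1 else 0)) = D i i'"
      \<comment> \<open>Row i of the remainder is gone after \<open>Suc i\<close> steps, which
        matches the range \<open>{..i}\<close>.\<close>
      using cholesky_sum[OF D, of i i' "Suc i"] schur_eq_0[OF D, of i "Suc i" i'] by (simp add: lessThan_Suc_atMost)
  qed
  from gaussian_family_reindex[OF this, of "to_nat_on T" T]
  have "gaussian_family white_noise T (\<lambda>t \<omega>. \<Sum>k\<in>{..to_nat_on T t}. cholesky D (to_nat_on T t) k * \<omega> (real k))
    (\<lambda>s t. D (to_nat_on T s) (to_nat_on T t))"
    by simp
  then have "gaussian_family white_noise T (\<lambda>t \<omega>. \<Sum>k\<in>{..to_nat_on T t}. cholesky D (to_nat_on T t) k * \<omega> (real k)) C"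
    by (rule gaussian_family_cov_cong) (simp add: D_def \<tau>_def T)
  then show ?thesis by blast
qed

subsection \<open>Spectral representation of the kernel\<close>

text \<open>Substitution gives \<open>\<integral> (1 - cos (x y)) y powr (- 1 - \<alpha>) dy = c * \<bar>x\<bar> powr \<alpha>\<close> over \<open>y > 0\<close>, with \<open>c > 0\<close> for \<open>0 < \<alpha> < 2\<close>,
  which turns \<open>(s + t) powr \<alpha> - \<bar>s - t\<bar> powr \<alpha>\<close> into an integral of \<open>2 sin (s y) sin (t y)\<close>.\<close>

definition spectral :: "real \<Rightarrow> real \<Rightarrow> real \<Rightarrow> real" where
  "spectral \<alpha> x y = indicator {0<..} y * ((1 - cos (x * y)) * y powr (- 1 - \<alpha>))"

lemma spectral_nonneg: "0 \<le> spectral \<alpha> x y"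
  by (auto simp: spectral_def)

lemma borel_measurable_spectral [measurable]: "spectral \<alpha> x \<in> borel_measurable borel"
  unfolding spectral_def by measurable

lemma one_minus_cos_le: "1 - cos (z::real) \<le> z\<^sup>2 / 2"
proof -
  have "cos z = 1 - 2 * (sin (z / 2))\<^sup>2"
    using cos_double_sin[of "z / 2"] by simp
  moreover have "(sin (z / 2))\<^sup>2 \<le> (z / 2)\<^sup>2"
    using abs_sin_x_le_abs_x[of "z / 2"] by (simp only: abs_le_square_iff)
  ultimately show ?thesis
    by (simp add: power_divide)
qed

lemma integrable_powr_indicator:
  fixes S :: "real set"
  assumes "(\<lambda>y. y powr a) integrable_on S" and [measurable]: "S \<in> sets borel"
  shows "integrable lborel (\<lambda>y. indicator S y * y powr a)"
proof -
  have "set_integrable lebesgue S (\<lambda>y. y powr a)"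
    by (rule nonnegative_absolutely_integrable_1[OF assms(1)]) simp
  then show ?thesis
    by (simp add: set_integrable_def integrable_completion)
qed

text \<open>Near 0 the quadratic bound on 1 - cos leaves y powr (1 - \<alpha>), integrable as
  \<alpha> < 2; at infinity the bound 2 leaves y powr (- 1 - \<alpha>), integrable as \<alpha> >
  0.\<close>

lemma integrable_spectral:
  assumes \<alpha>: "0 < \<alpha>" "\<alpha> < 2"
  shows "integrable lborel (spectral \<alpha> x)"
proof (rule Bochner_Integration.integrable_bound)
  let ?g = "\<lambda>y. x\<^sup>2 * (indicator {0..1} y * y powr (1 - \<alpha>)) + 2 * (indicator {1..} y * y powr (- 1 - \<alpha>))"
  show "integrable lborel ?g"
    using \<alpha> by (intro Bochner_Integration.integrable_add integrable_mult_right integrable_powr_indicator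
        integrable_on_powr_from_0 has_integral_integrable[OF has_integral_powr_to_inf]) auto
  have "spectral \<alpha> x y \<le> ?g y" for y
  proof (cases "0 < y")
    case pos: True
    show ?thesis
    proof (cases "y \<le> 1")
      case True
      have "(1 - cos (x * y)) * y powr (- 1 - \<alpha>) \<le> (x * y)\<^sup>2 * y powr (- 1 - \<alpha>)"
        using one_minus_cos_le[of "x * y"] zero_le_power2[of "x * y"] by (intro mult_right_mono) (linarith, simp)
      also have "\<dots> = x\<^sup>2 * (y powr 2 * y powr (- 1 - \<alpha>))"
        using pos by (simp add: power_mult_distrib)
      also have "y powr 2 * y powr (- 1 - \<alpha>) = y powr (1 - \<alpha>)"
        unfolding powr_add[symmetric] by simp
      finally show ?thesis
        using pos True by (auto simp: spectral_def indicator_def intro: order_trans)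
    next
      case False
      have "1 - cos (x * y) \<le> 2"
        using cos_ge_minus_one[of "x * y"] by linarith
      then have "(1 - cos (x * y)) * y powr (- 1 - \<alpha>) \<le> 2 * y powr (- 1 - \<alpha>)"
        by (intro mult_right_mono) auto
      then show ?thesis
        using pos False by (auto simp: spectral_def)
    qed
  qed (auto simp: spectral_def)
  then show "AE y in lborel. norm (spectral \<alpha> x y) \<le> norm (?g y)"
    using spectral_nonneg by (intro AE_I2) (auto intro: order_trans[OF _ abs_ge_self])
qed simp

definition spectral_const :: "real \<Rightarrow> real" where
  "spectral_const \<alpha> = (LINT y|lborel. spectral \<alpha> 1 y)"

lemma integral_spectral:
  "(LINT y|lborel. spectral \<alpha> x y) = \<bar>x\<bar> powr \<alpha> * spectral_const \<alpha>"
proof (cases "x = 0")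
  case True
  then show ?thesis by (simp add: spectral_def)
next
  case False
  define c where "c = \<bar>x\<bar>"
  have c: "0 < c" using False by (simp add: c_def)
  have "cos (x * y) = cos (c * y)" for y
    by (cases "0 \<le> x") (auto simp: c_def)
  then have "(LINT y|lborel. spectral \<alpha> x y) = (LINT y|lborel. spectral \<alpha> c y)"
    by (simp add: spectral_def)
  also have "\<dots> = \<bar>1 / c\<bar> *\<^sub>R (LINT y|lborel. spectral \<alpha> c (0 + (1 / c) * y))"
    using c by (intro lborel_integral_real_affine) auto
  also have "(\<lambda>y. spectral \<alpha> c (0 + (1 / c) * y)) = (\<lambda>y. c powr (1 + \<alpha>) * spectral \<alpha> 1 y)"
  proof
    fix y
    have "(y / c) powr (- 1 - \<alpha>) = c powr (1 + \<alpha>) * y powr (- 1 - \<alpha>)" if "0 < y"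
    proof -
      have "(y / c) powr (- 1 - \<alpha>) = y powr (- 1 - \<alpha>) / c powr (- (1 + \<alpha>))"
        using that c by (simp add: powr_divide)
      then show ?thesis
        by (simp only: powr_minus_divide) simp
    qed
    then show "spectral \<alpha> c (0 + (1 / c) * y) = c powr (1 + \<alpha>) * spectral \<alpha> 1 y"
      using c by (auto simp: spectral_def indicator_def zero_less_divide_iff)
  qed
  also have "\<bar>1 / c\<bar> *\<^sub>R (LINT y|lborel. c powr (1 + \<alpha>) * spectral \<alpha> 1 y) = c powr \<alpha> * spectral_const \<alpha>"
    using c by (simp add: spectral_const_def powr_add)
  finally show ?thesis
    by (simp add: c_def)
qed

text \<open>On the interval from pi / 2 to pi the cosine is at most 0 and the decreasing power is at
  least its value at pi, so a multiple of an indicator is a positive minorant.\<close>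

lemma spectral_const_pos:
  assumes \<alpha>: "0 < \<alpha>" "\<alpha> < 2"
  shows "0 < spectral_const \<alpha>"
proof -
  have "0 < pi / 2 * pi powr (- 1 - \<alpha>)"
    by simp
  also have "\<dots> = (LINT y|lborel. indicator {pi/2..pi} y * pi powr (- 1 - \<alpha>))"
    by simp
  also have "\<dots> \<le> spectral_const \<alpha>"
    unfolding spectral_const_def
  proof (rule integral_mono)
    show "integrable lborel (\<lambda>y. indicator {pi/2..pi} y * pi powr (- 1 - \<alpha>))"
      by (intro integrable_mult_left integrable_real_indicator) auto
    show "integrable lborel (spectral \<alpha> 1)"
      by (rule integrable_spectral[OF \<alpha>])
    show "indicator {pi/2..pi} y * pi powr (- 1 - \<alpha>) \<le> spectral \<alpha> 1 y" for y
    proof (cases "y \<in> {pi/2..pi}")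
      case True
      then have y: "0 < y"
        using pi_gt_zero by (auto intro: less_le_trans[of 0 "pi / 2"])
      have "cos y \<le> cos (pi / 2)"
        using True by (intro cos_monotone_0_pi_le) auto
      moreover have "pi powr (- 1 - \<alpha>) \<le> y powr (- 1 - \<alpha>)"
        using True y \<alpha> by (intro powr_mono2') auto
      ultimately have "1 * pi powr (- 1 - \<alpha>) \<le> (1 - cos y) * y powr (- 1 - \<alpha>)"
        by (intro mult_mono) auto
      then show ?thesis
        using True y by (simp add: spectral_def)
    qed (simp add: spectral_nonneg)
  qed
  finally show ?thesis .
qed

definition sine_kernel :: "real \<Rightarrow> real \<Rightarrow> real \<Rightarrow> real" where
  "sine_kernel \<alpha> s t = (s + t) powr \<alpha> - \<bar>s - t\<bar> powr \<alpha>"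

lemma sine_kernel_two: "0 \<le> s \<Longrightarrow> 0 \<le> t \<Longrightarrow> sine_kernel 2 s t = 4 * s * t"
  by (simp add: sine_kernel_def power2_eq_square algebra_simps)

lemma sine_kernel_sym: "sine_kernel \<alpha> s t = sine_kernel \<alpha> t s"
  by (simp add: sine_kernel_def add.commute abs_minus_commute)

lemma sine_kernel_spectral:
  assumes \<alpha>: "0 < \<alpha>" "\<alpha> < 2" and st: "0 \<le> s" "0 \<le> t"
  shows "sine_kernel \<alpha> s t * spectral_const \<alpha> =
    (LINT y|lborel. indicator {0<..} y * (2 * sin (s * y) * sin (t * y) * y powr (- 1 - \<alpha>)))"
    and "integrable lborel (\<lambda>y. indicator {0<..} y * (2 * sin (s * y) * sin (t * y) * y powr (- 1 - \<alpha>)))"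
proof -
  have eq: "indicator {0<..} y * (2 * sin (s * y) * sin (t * y) * y powr (- 1 - \<alpha>)) =
      spectral \<alpha> (s + t) y - spectral \<alpha> (s - t) y" for y
    by (simp add: spectral_def distrib_right left_diff_distrib cos_add cos_diff algebra_simps)
  show "sine_kernel \<alpha> s t * spectral_const \<alpha> =
    (LINT y|lborel. indicator {0<..} y * (2 * sin (s * y) * sin (t * y) * y powr (- 1 - \<alpha>)))"
    unfolding eq using st integrable_spectral[OF \<alpha>]
    by (simp add: integral_spectral sine_kernel_def left_diff_distrib)
  show "integrable lborel (\<lambda>y. indicator {0<..} y * (2 * sin (s * y) * sin (t * y) * y powr (- 1 - \<alpha>)))"
    unfolding eq using integrable_spectral[OF \<alpha>] by simp
qed

text \<open>Under the integral the quadratic form becomes a nonnegative multiple of the square of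
  \<Sum> a s sin (s y). For \<alpha> = 2 the form is itself the square of \<Sum> 2 a s s.\<close>

lemma pos_semidef_sine_kernel:
  assumes \<alpha>: "0 < \<alpha>" "\<alpha> \<le> 2"
  shows "pos_semidef {0..} (sine_kernel \<alpha>)"
proof -
  have "0 \<le> (\<Sum>s\<in>J. \<Sum>t\<in>J. a s * a t * sine_kernel \<alpha> s t)" if J: "finite J" "J \<subseteq> {0..}" for J a
  proof (cases "\<alpha> = 2")
    case True
    have "(\<Sum>s\<in>J. \<Sum>t\<in>J. a s * a t * sine_kernel \<alpha> s t) = (\<Sum>s\<in>J. \<Sum>t\<in>J. (2 * a s * s) * (2 * a t * t))"
      using J sine_kernel_two True by (intro sum.cong refl) (auto simp: subset_iff)
    also have "\<dots> = (\<Sum>s\<in>J. 2 * a s * s)\<^sup>2"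
      by (simp only: power2_eq_square sum_product)
    finally show ?thesis by simp
  next
    case False
    then have \<alpha>2: "\<alpha> < 2" using \<alpha> by simp
    let ?f = "\<lambda>s t y. indicator {0<..} y * (2 * sin (s * y) * sin (t * y) * y powr (- 1 - \<alpha>))"
    have J0: "0 \<le> s" if "s \<in> J" for s
      using that J by auto
    have "(\<Sum>s\<in>J. \<Sum>t\<in>J. a s * a t * sine_kernel \<alpha> s t) * spectral_const \<alpha> =
      (\<Sum>s\<in>J. \<Sum>t\<in>J. a s * a t * (LINT y|lborel. ?f s t y))"
      unfolding sum_distrib_right using sine_kernel_spectral(1)[OF \<alpha>(1) \<alpha>2 J0 J0]
      by (intro sum.cong refl) (simp add: mult.assoc)
    also have "\<dots> = (LINT y|lborel. (\<Sum>s\<in>J. \<Sum>t\<in>J. a s * a t * ?f s t y))"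
      using sine_kernel_spectral(2)[OF \<alpha>(1) \<alpha>2 J0 J0]
      by (subst Bochner_Integration.integral_sum)
         (auto intro!: Bochner_Integration.integrable_sum sum.cong integrable_mult_right
            simp: Bochner_Integration.integral_sum)
    also have "\<dots> \<ge> 0"
    proof (rule Bochner_Integration.integral_nonneg)
      fix y
      have "(\<Sum>s\<in>J. \<Sum>t\<in>J. a s * a t * ?f s t y) =
        (\<Sum>s\<in>J. \<Sum>t\<in>J. (2 * indicator {0<..} y * y powr (- 1 - \<alpha>)) * ((a s * sin (s * y)) * (a t * sin (t * y))))"
        by (intro sum.cong refl) (simp add: mult_ac)
      also have "\<dots> = (2 * indicator {0<..} y * y powr (- 1 - \<alpha>)) * (\<Sum>s\<in>J. a s * sin (s * y))\<^sup>2"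
        unfolding power2_eq_square sum_product unfolding sum_distrib_left ..
      finally show "0 \<le> (\<Sum>s\<in>J. \<Sum>t\<in>J. a s * a t * ?f s t y)"
        by simp
    qed
    finally show ?thesis
      using spectral_const_pos[OF \<alpha>(1) \<alpha>2] by (simp add: zero_le_mult_iff)
  qed
  then show ?thesis
    using sine_kernel_sym by (auto simp: pos_semidef_def)
qed

text \<open>The left side is (2s)^\<alpha> + (2t)^\<alpha> - 2 (s + t)^\<alpha>, plus 2 |s -
  t|^\<alpha>. In the spectral integral, writing 2s and 2t as (s + t) plus or minus (s - t) turns
  the first three terms into 2 cos ((s + t) y) (1 - cos ((s - t) y)), and bounding the first cosine
  by 1 gives another 2 |s - t|^\<alpha>.\<close>

lemma sine_kernel_increment_le:
  assumes \<alpha>: "0 < \<alpha>" "\<alpha> \<le> 2" and st: "0 \<le> s" "0 \<le> t"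
  shows "sine_kernel \<alpha> s s + sine_kernel \<alpha> t t - 2 * sine_kernel \<alpha> s t \<le> 4 * \<bar>s - t\<bar> powr \<alpha>"
proof (cases "\<alpha> = 2")
  case True
  then show ?thesis
    using st by (simp add: sine_kernel_two power2_eq_square algebra_simps)
next
  case False
  then have \<alpha>2: "\<alpha> < 2" using \<alpha> by simp
  note int = integrable_spectral[OF \<alpha>(1) \<alpha>2]
  have "((2 * s) powr \<alpha> + (2 * t) powr \<alpha> - 2 * (s + t) powr \<alpha>) * spectral_const \<alpha> =
    (LINT y|lborel. spectral \<alpha> (2 * s) y + spectral \<alpha> (2 * t) y - 2 * spectral \<alpha> (s + t) y)"
    using int st by (simp add: integral_spectral algebra_simps)
  also have "\<dots> \<le> (LINT y|lborel. 2 * spectral \<alpha> (s - t) y)"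
  proof (rule integral_mono)
    fix y
    have "2 * s = (s + t) + (s - t)" "2 * t = (s + t) - (s - t)" by auto
    then have "cos (2 * s * y) + cos (2 * t * y) = 2 * cos ((s + t) * y) * cos ((s - t) * y)"
      by (simp only: distrib_right[of "s + t" "s - t"] left_diff_distrib[of "s + t" "s - t"] cos_add cos_diff)
    moreover have "cos ((s + t) * y) * (1 - cos ((s - t) * y)) \<le> 1 * (1 - cos ((s - t) * y))"
      by (intro mult_right_mono) auto
    ultimately have "((1 - cos (2 * s * y)) + (1 - cos (2 * t * y)) - 2 * (1 - cos ((s + t) * y))) * y powr (- 1 - \<alpha>)
      \<le> (2 * (1 - cos ((s - t) * y))) * y powr (- 1 - \<alpha>)"
      by (intro mult_right_mono) (auto simp: algebra_simps)
    then show "spectral \<alpha> (2 * s) y + spectral \<alpha> (2 * t) y - 2 * spectral \<alpha> (s + t) y \<le> 2 * spectral \<alpha> (s - t) y"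
      by (auto simp: spectral_def indicator_def algebra_simps)
  qed (use int in auto)
  also have "\<dots> = (2 * \<bar>s - t\<bar> powr \<alpha>) * spectral_const \<alpha>"
    by (simp add: integral_spectral)
  finally have "(2 * s) powr \<alpha> + (2 * t) powr \<alpha> - 2 * (s + t) powr \<alpha> \<le> 2 * \<bar>s - t\<bar> powr \<alpha>"
    using spectral_const_pos[OF \<alpha>(1) \<alpha>2] by simp
  then show ?thesis
    using \<alpha> by (simp add: sine_kernel_def)
qed

subsection \<open>Continuous Gaussian processes\<close>

text \<open>Under dyadic refinement cell k splits into the cells 2 k and 2 k + 1.\<close>

lemma nat_floor_double:
  assumes "0 \<le> (x::real)"
  shows "nat \<lfloor>2 * x\<rfloor> = 2 * nat \<lfloor>x\<rfloor> \<or> nat \<lfloor>2 * x\<rfloor> = Suc (2 * nat \<lfloor>x\<rfloor>)"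
proof -
  have "\<lfloor>2 * x\<rfloor> = 2 * \<lfloor>x\<rfloor> \<or> \<lfloor>2 * x\<rfloor> = 2 * \<lfloor>x\<rfloor> + 1"
    by linarith
  moreover have "0 \<le> \<lfloor>x\<rfloor>"
    using assms by simp
  ultimately show ?thesis by linarith
qed

lemma nat_floor_less: "0 \<le> (x::real) \<Longrightarrow> x < real n \<Longrightarrow> nat \<lfloor>x\<rfloor> < n"
  by linarith

text \<open>\<open>f n k\<close> is the value at \<open>k / 2 ^ n\<close>.\<close>

locale dyadic_chaining =
  fixes f :: "nat \<Rightarrow> nat \<Rightarrow> real" and r :: real
  assumes r: "0 < r" "r < 1"
    and coarse: "f (Suc n) (2 * k) = f n k"
    and increments: "\<exists>A. \<forall>n k. k < N * 2 ^ n \<longrightarrow> \<bar>f n (Suc k) - f n k\<bar> \<le> A * r ^ n"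
begin

definition step :: "nat \<Rightarrow> real \<Rightarrow> real" where
  "step n t = f n (nat \<lfloor>2 ^ n * t\<rfloor>)"

lemma increment_bound:
  obtains A where "0 \<le> A" and "\<And>n k. k < N * 2 ^ n \<Longrightarrow> \<bar>f n (Suc k) - f n k\<bar> \<le> A * r ^ n"
proof -
  obtain A where A: "\<And>n k. k < N * 2 ^ n \<Longrightarrow> \<bar>f n (Suc k) - f n k\<bar> \<le> A * r ^ n"
    using increments[of N] by blast
  have "\<bar>f n (Suc k) - f n k\<bar> \<le> \<bar>A\<bar> * r ^ n" if "k < N * 2 ^ n" for n k
    by (intro order_trans[OF A[OF that]] mult_right_mono) (use r in auto)
  then show ?thesis
    using that[of "\<bar>A\<bar>"] by simp
qed

lemma step_Cauchy_bound:
  assumes A: "0 \<le> A" "\<And>n k. k < N * 2 ^ n \<Longrightarrow> \<bar>f n (Suc k) - f n k\<bar> \<le> A * r ^ n"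
    and t: "0 \<le> t" "t < real N" and "n \<le> m"
  shows "\<bar>step m t - step n t\<bar> \<le> A * r ^ n / (1 - r)"
proof -
  have one: "\<bar>step (Suc n) t - step n t\<bar> \<le> A * r ^ n" for n
  proof -
    define k where "k = nat \<lfloor>2 ^ n * t\<rfloor>"
    \<comment> \<open>The left endpoint at level n + 1 is either the old one, where
      \<open>coarse\<close> applies, or one fine grid step to its right.\<close>
    have "nat \<lfloor>2 ^ Suc n * t\<rfloor> = 2 * k \<or> nat \<lfloor>2 ^ Suc n * t\<rfloor> = Suc (2 * k)"
      unfolding k_def using nat_floor_double[of "2 ^ n * t"] t by (simp add: mult.assoc)
    moreover have "k < N * 2 ^ n"
      unfolding k_def using t by (intro nat_floor_less) auto
    then have "\<bar>f (Suc n) (Suc (2 * k)) - f (Suc n) (2 * k)\<bar> \<le> A * r ^ Suc n"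
      by (intro A) simp
    moreover have "A * r ^ Suc n \<le> A * r ^ n"
      using A(1) r by (intro mult_left_mono power_decreasing) auto
    ultimately show ?thesis
      unfolding step_def k_def[symmetric] using A(1) r coarse[of n k] by fastforce
  qed
  \<comment> \<open>The claim is sharpened for the induction: the difference of the two tails is
    exactly the partial geometric sum.\<close>
  have "\<bar>step m t - step n t\<bar> \<le> A * r ^ n / (1 - r) - A * r ^ m / (1 - r)"
    using \<open>n \<le> m\<close>
  proof (induction m rule: dec_induct)
    case (step m)
    have "A * r ^ m / (1 - r) - A * r ^ Suc m / (1 - r) = A * r ^ m * (1 - r) / (1 - r)"
      by (simp add: diff_divide_distrib algebra_simps)
    also have "\<dots> = A * r ^ m"
      using r by simp
    finally have "A * r ^ m / (1 - r) - A * r ^ Suc m / (1 - r) = A * r ^ m" .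
    then show ?case
      using step.IH one[of m] by linarith
  qed simp
  moreover have "0 \<le> A * r ^ m / (1 - r)"
    using A(1) r by simp
  ultimately show ?thesis by linarith
qed

lemma bound_tendsto_0: "(\<lambda>n. A * r ^ n / (1 - r)) \<longlonglongrightarrow> 0"
proof -
  have "(\<lambda>n. A * r ^ n / (1 - r)) \<longlonglongrightarrow> A * 0 / (1 - r)"
    using r by (intro tendsto_intros LIMSEQ_realpow_zero) auto
  then show ?thesis by simp
qed

lemma convergent_step:
  assumes "0 \<le> t"
  shows "(\<lambda>n. step n t) \<longlonglongrightarrow> lim (\<lambda>n. step n t)"
proof -
  obtain N where N: "t < real N"
    using reals_Archimedean2 by blast
  obtain A where A: "0 \<le> A" "\<And>n k. k < N * 2 ^ n \<Longrightarrow> \<bar>f n (Suc k) - f n k\<bar> \<le> A * r ^ n"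
    using increment_bound[of N] by blast
  have "Cauchy (\<lambda>n. step n t)"
  proof (rule metric_CauchyI)
    fix e :: real assume "0 < e"
    then have "\<forall>\<^sub>F n in sequentially. A * r ^ n / (1 - r) < e / 2"
      using order_tendstoD(2)[OF bound_tendsto_0, of "e / 2"] by simp
    then obtain M where M: "A * r ^ M / (1 - r) < e / 2"
      by (auto simp: eventually_sequentially)
    have "dist (step m t) (step n t) < e" if "M \<le> m" "M \<le> n" for m n
      using step_Cauchy_bound[OF A assms N that(1)] step_Cauchy_bound[OF A assms N that(2)] M
      unfolding dist_real_def by linarith
    then show "\<exists>M. \<forall>m\<ge>M. \<forall>n\<ge>M. dist (step m t) (step n t) < e"
      by blast
  qed
  then show ?thesis
    by (simp add: Cauchy_convergent_iff convergent_LIMSEQ_iff)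
qed

text \<open>A three-epsilon argument: below N the limit is uniformly close to the level n step
  function, and for times less than 1 / 2 ^ n apart the step values are equal or differ by one grid
  increment. Taking N > s + 1 and distance below 1 keeps both times in that range.\<close>

lemma continuous_on_lim_step: "continuous_on {0..} (\<lambda>t. lim (\<lambda>n. step n t))"
  unfolding continuous_on_iff
proof (intro ballI allI impI)
  fix s e :: real assume s: "s \<in> {0..}" and e: "0 < e"
  obtain N where N: "s + 1 < real N"
    using reals_Archimedean2 by blast
  obtain A where A: "0 \<le> A" "\<And>n k. k < N * 2 ^ n \<Longrightarrow> \<bar>f n (Suc k) - f n k\<bar> \<le> A * r ^ n"
    using increment_bound[of N] by blast
  have "\<forall>\<^sub>F n in sequentially. A * r ^ n / (1 - r) < e / 3"
    using order_tendstoD(2)[OF bound_tendsto_0, of "e / 3"] e by simp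
  then obtain n where n: "A * r ^ n / (1 - r) < e / 3"
    by (auto simp: eventually_sequentially)
  have "A * r ^ n * (1 - r) \<le> A * r ^ n * 1"
    using A(1) r by (intro mult_left_mono) auto
  then have An: "A * r ^ n \<le> A * r ^ n / (1 - r)"
    using r by (simp add: field_simps)
  have near: "\<bar>lim (\<lambda>n. step n u) - step n u\<bar> \<le> A * r ^ n / (1 - r)" if "0 \<le> u" "u < real N" for u
  proof (rule LIMSEQ_le_const2)
    show "(\<lambda>m. \<bar>step m u - step n u\<bar>) \<longlonglongrightarrow> \<bar>lim (\<lambda>n. step n u) - step n u\<bar>"
      using convergent_step[OF that(1)] by (intro tendsto_intros)
    show "\<exists>M. \<forall>m\<ge>M. \<bar>step m u - step n u\<bar> \<le> A * r ^ n / (1 - r)"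
      using step_Cauchy_bound[OF A that] by blast
  qed
  have step_near: "\<bar>step n v - step n u\<bar> \<le> A * r ^ n" if u: "0 \<le> u" "u \<le> v" "v < real N" "v - u < 1 / 2 ^ n" for u v
  proof -
    have "2 ^ n * v < 2 ^ n * u + 1"
      using that(4) by (simp add: field_simps)
    moreover have "2 ^ n * u \<le> 2 ^ n * v" "0 \<le> 2 ^ n * u"
      using u by auto
    ultimately have "nat \<lfloor>2 ^ n * v\<rfloor> = nat \<lfloor>2 ^ n * u\<rfloor> \<or> nat \<lfloor>2 ^ n * v\<rfloor> = Suc (nat \<lfloor>2 ^ n * u\<rfloor>)"
      by linarith
    moreover have "nat \<lfloor>2 ^ n * u\<rfloor> < N * 2 ^ n"
      using u by (intro nat_floor_less) auto
    ultimately show ?thesis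
      unfolding step_def using A r by fastforce
  qed
  have "dist (lim (\<lambda>n. step n t)) (lim (\<lambda>n. step n s)) < e"
    if t: "t \<in> {0..}" "dist t s < min 1 (1 / 2 ^ n)" for t
  proof -
    have ts: "0 \<le> t" "0 \<le> s" "t < real N" "s < real N" "\<bar>t - s\<bar> < 1 / 2 ^ n"
      using t s N unfolding dist_real_def by (simp_all, linarith)
    have "\<bar>step n t - step n s\<bar> \<le> A * r ^ n"
      using step_near[of s t] step_near[of t s] ts by (cases "s \<le> t") auto
    then show ?thesis
      using near[OF ts(1,3)] near[OF ts(2,4)] An n unfolding dist_real_def by linarith
  qed
  then show "\<exists>d>0. \<forall>t\<in>{0..}. dist t s < d \<longrightarrow> dist (lim (\<lambda>n. step n t)) (lim (\<lambda>n. step n s)) < e"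
    by (intro exI[of _ "min 1 (1 / 2 ^ n)"]) auto
qed

end

text \<open>The 8 is 2 times 2 times 2: one factor for the number of increments per unit of time,
  one for the weight 2 ^ n, the inverse of r ^ (2 p n), and one that leaves a summable expectation.
  The sum over n of the weighted moment sums S n is then almost surely finite and bounds every
  single increment.\<close>

lemma AE_dyadic_increments:
  fixes D :: "nat \<Rightarrow> nat \<Rightarrow> 'a \<Rightarrow> real"
  assumes [measurable]: "\<And>n k. D n k \<in> borel_measurable M"
    and int: "\<And>n k. integrable M (\<lambda>\<omega>. D n k \<omega> ^ (2 * p))"
    and le: "\<And>n k. (LINT \<omega>|M. D n k \<omega> ^ (2 * p)) \<le> c / 8 ^ n"
    and p: "0 < p" and r: "0 < r" "r ^ (2 * p) = 1 / 2"
  shows "AE \<omega> in M. \<forall>N. \<exists>A. \<forall>n k. k < N * 2 ^ n \<longrightarrow> \<bar>D n k \<omega>\<bar> \<le> A * r ^ n"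
  unfolding AE_all_countable
proof
  fix N :: nat
  define S where "S n \<omega> = 2 ^ n * (\<Sum>k<N * 2 ^ n. D n k \<omega> ^ (2 * p))" for n \<omega>
  have S0: "0 \<le> S n \<omega>" for n \<omega>
    unfolding S_def by (intro mult_nonneg_nonneg sum_nonneg) auto
  have [measurable]: "S n \<in> borel_measurable M" for n
    unfolding S_def by measurable
  have Sint: "integrable M (S n)" for n
    unfolding S_def by (intro integrable_mult_right Bochner_Integration.integrable_sum int)
  have "0 \<le> (LINT \<omega>|M. D 0 0 \<omega> ^ (2 * p))"
    by (intro Bochner_Integration.integral_nonneg) simp
  also have "\<dots> \<le> c / 8 ^ 0"
    by (rule le)
  finally have c0: "0 \<le> c" by simp
  have "(LINT \<omega>|M. S n \<omega>) \<le> real N * c * (1 / 2) ^ n" for n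
  proof -
    have "(LINT \<omega>|M. S n \<omega>) = 2 ^ n * (\<Sum>k<N * 2 ^ n. LINT \<omega>|M. D n k \<omega> ^ (2 * p))"
      unfolding S_def using int by (simp add: Bochner_Integration.integral_sum)
    also have "\<dots> \<le> 2 ^ n * (\<Sum>k<N * 2 ^ n. c / 8 ^ n)"
      by (intro mult_left_mono sum_mono le) simp
    also have "\<dots> = real N * c * ((2 * 2) / 8) ^ n"
      unfolding power_divide power_mult_distrib by simp
    finally show ?thesis by simp
  qed
  then have nnS: "(\<integral>\<^sup>+\<omega>. ennreal (S n \<omega>) \<partial>M) \<le> ennreal (real N * c * (1 / 2) ^ n)" for n
    using Sint S0 by (subst nn_integral_eq_integral) (auto intro: ennreal_leI)
  have "(\<integral>\<^sup>+\<omega>. (\<Sum>n. ennreal (S n \<omega>)) \<partial>M) = (\<Sum>n. \<integral>\<^sup>+\<omega>. ennreal (S n \<omega>) \<partial>M)"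
    by (rule nn_integral_suminf) measurable
  also have "\<dots> \<le> (\<Sum>n. ennreal (real N * c * (1 / 2) ^ n))"
    by (intro suminf_le nnS) auto
  also have "\<dots> = ennreal (\<Sum>n. real N * c * (1 / 2) ^ n)"
    using c0 by (intro suminf_ennreal2) (auto intro!: summable_mult summable_geometric)
  also have "\<dots> < \<infinity>"
    by simp
  finally have "AE \<omega> in M. (\<Sum>n. ennreal (S n \<omega>)) \<noteq> \<infinity>"
    by (intro nn_integral_PInf_AE) auto
  then show "AE \<omega> in M. \<exists>A. \<forall>n k. k < N * 2 ^ n \<longrightarrow> \<bar>D n k \<omega>\<bar> \<le> A * r ^ n"
  proof eventually_elim
    case (elim \<omega>)
    define W where "W = (\<Sum>n. ennreal (S n \<omega>))"
    \<comment> \<open>Adding 1 makes A \<ge> 1, so that A \<le> A ^ (2 * p) and one constant serves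
      after taking the root of order 2p.\<close>
    define A where "A = enn2real W + 1"
    have A1: "1 \<le> A" by (simp add: A_def)
    have "\<bar>D n k \<omega>\<bar> \<le> A * r ^ n" if k: "k < N * 2 ^ n" for n k
    proof -
      have "ennreal (S n \<omega>) \<le> W"
        unfolding W_def using sum_le_suminf[of "\<lambda>n. ennreal (S n \<omega>)" "{n}"] by simp
      then have "S n \<omega> \<le> enn2real W"
        using elim S0 by (metis W_def enn2real_ennreal enn2real_mono infinity_ennreal_def top.not_eq_extremum)
      then have "S n \<omega> \<le> A" by (simp add: A_def)
      moreover have "D n k \<omega> ^ (2 * p) \<le> (\<Sum>k<N * 2 ^ n. D n k \<omega> ^ (2 * p))"
        by (rule member_le_sum) (use k in auto)
      then have "2 ^ n * D n k \<omega> ^ (2 * p) \<le> S n \<omega>"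
        by (simp add: S_def)
      moreover have "A ^ 1 \<le> A ^ (2 * p)"
        using A1 p by (intro power_increasing) auto
      ultimately have "2 ^ n * D n k \<omega> ^ (2 * p) \<le> A ^ (2 * p)"
        by simp
      then have "D n k \<omega> ^ (2 * p) \<le> A ^ (2 * p) * (1 / 2) ^ n"
        by (simp add: field_simps)
      also have "\<dots> = (A * r ^ n) ^ (2 * p)"
        unfolding r(2)[symmetric] by (simp add: power_mult_distrib power_mult[symmetric] mult.commute)
      finally have "\<bar>D n k \<omega>\<bar> ^ (2 * p) \<le> (A * r ^ n) ^ (2 * p)"
        by (simp add: power_even_abs)
      then show ?thesis
        using A1 r p by (subst (asm) power_mono_iff) auto
    qed
    then show ?case by blast
  qed
qed


text \<open>The process is built on the dyadic rationals, and its chaining limits are read at left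
  dyadic endpoints. Continuity of C transfers the covariance to these limits; it is stated by
  sequences because that is how the endpoints approach s and t.\<close>

lemma ex_continuous_gaussian_family:
  assumes C: "pos_semidef {0..} C" and \<alpha>: "0 < \<alpha>"
    and incr: "\<And>s t. 0 \<le> s \<Longrightarrow> 0 \<le> t \<Longrightarrow> C s s + C t t - 2 * C s t \<le> B * \<bar>s - t\<bar> powr \<alpha>"
    and cont: "\<And>s t u v. 0 \<le> s \<Longrightarrow> 0 \<le> t \<Longrightarrow> (\<And>n::nat. 0 \<le> u n \<and> 0 \<le> v n) \<Longrightarrow> u \<longlonglongrightarrow> s \<Longrightarrow> v \<longlonglongrightarrow> t \<Longrightarrow>
      (\<lambda>n. C (u n) (v n)) \<longlonglongrightarrow> C s t"
  shows "\<exists>\<theta>. gaussian_family white_noise {0..} \<theta> C \<and> continuous_paths white_noise \<theta>"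
proof -
  define d where "d n k = real k / 2 ^ n" for n k :: nat
  define T where "T = range (case_prod d)"
  have T: "countable T" "T \<noteq> {}" "T \<subseteq> {0..}" "d n k \<in> T" for n k
  proof -
    show "d n k \<in> T"
      unfolding T_def by (rule range_eqI[of _ _ "(n, k)"]) simp
    show "T \<subseteq> {0..}"
      by (auto simp: T_def d_def)
  qed (simp_all add: T_def)
  have "pos_semidef T C"
    by (rule pos_semidef_subset[OF C T(3)])
  then obtain X where X: "gaussian_family white_noise T X C"
    using ex_gaussian_family_countable[OF T(1,2)] by blast
  interpret prob_space white_noise
    by (rule gaussian_family_prob_space[OF X])
  have Xm: "X (d n k) \<in> borel_measurable white_noise" for n k
    using gaussian_family_measurable[OF X T(4)] .
  have B0: "0 \<le> B"
  proof -
    have "0 \<le> C 0 0 + C 1 1 - 2 * C 0 1"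
      using pos_semidef_nonneg[OF C, of "{0, 1}" "\<lambda>t. if t = 0 then 1 else -1"] pos_semidef_sym[OF C, of 0 1] by simp
    then show ?thesis using incr[of 0 1] by simp
  qed
  define D where "D n k \<omega> = X (d n (Suc k)) \<omega> - X (d n k) \<omega>" for n k \<omega>
  \<comment> \<open>At level n the increments have variance at most
    \<open>B * (1 / 2 ^ n) powr \<alpha>\<close>; once 3 \<le> \<alpha> p, its p-th power is at most
    \<open>B ^ p / 8 ^ n\<close>, the decay that \<open>AE_dyadic_increments\<close> asks
    for.\<close>
  obtain p :: nat where p: "3 / \<alpha> < real p"
    using reals_Archimedean2 by blast
  have p0: "0 < p" and p\<alpha>: "3 \<le> \<alpha> * real p"
  proof -
    show "0 < p"
      using p \<alpha> by (cases p) auto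
    show "3 \<le> \<alpha> * real p"
      using p \<alpha> by (simp add: pos_divide_less_eq mult.commute)
  qed
  define c where "c = B ^ p * (fact (2 * p) / (2 ^ p * fact p))"
  have D: "has_bochner_integral white_noise (\<lambda>\<omega>. D n k \<omega> ^ (2 * p))
      ((C (d n k) (d n k) + C (d n (Suc k)) (d n (Suc k)) - 2 * C (d n k) (d n (Suc k))) ^ p * (fact (2 * p) / (2 ^ p * fact p)))"
    for n k
  proof -
    have ne: "d n k \<noteq> d n (Suc k)"
      by (simp add: d_def)
    show ?thesis
      using gaussian_family_moments(1)[OF X, of "{d n (Suc k), d n k}" "\<lambda>t. if t = d n k then -1 else 1" p] ne T
        pos_semidef_sym[OF C, of "d n k" "d n (Suc k)"]
      by (simp add: D_def algebra_simps subset_iff)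
  qed
  have le: "(LINT \<omega>|white_noise. D n k \<omega> ^ (2 * p)) \<le> c / 8 ^ n" for n k
  proof -
    let ?v = "C (d n k) (d n k) + C (d n (Suc k)) (d n (Suc k)) - 2 * C (d n k) (d n (Suc k))"
    have "0 \<le> ?v"
      using pos_semidef_nonneg[OF C, of "{d n k, d n (Suc k)}" "\<lambda>t. if t = d n k then -1 else 1"]
        pos_semidef_sym[OF C, of "d n k" "d n (Suc k)"] T by (simp add: d_def algebra_simps)
    moreover have "?v \<le> B * (1 / 2 ^ n) powr \<alpha>"
      using incr[of "d n k" "d n (Suc k)"] by (simp add: d_def diff_divide_distrib[symmetric])
    ultimately have "?v ^ p \<le> (B * (1 / 2 ^ n) powr \<alpha>) ^ p"
      by (intro power_mono)
    also have "\<dots> = B ^ p * (1 / 2 ^ n) powr (\<alpha> * real p)"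
      by (simp add: power_mult_distrib powr_powr[symmetric] powr_realpow)
    also have "\<dots> \<le> B ^ p * (1 / 2 ^ n) powr 3"
      using B0 p\<alpha> by (intro mult_left_mono powr_mono') auto
    also have "(1 / 2 ^ n) powr 3 = (1 / 8 ^ n :: real)"
    proof -
      have "(1 / 2 ^ n) powr 3 = ((1 / 2 ^ n) ^ 3 :: real)"
        by simp
      also have "\<dots> = 1 / (2 ^ 3) ^ n"
        by (simp only: power_divide power_mult[symmetric] mult.commute power_one)
      finally show ?thesis by simp
    qed
    finally have "?v ^ p * (fact (2 * p) / (2 ^ p * fact p)) \<le> B ^ p * (1 / 8 ^ n) * (fact (2 * p) / (2 ^ p * fact p))"
      by (intro mult_right_mono) auto
    then show ?thesis
      using D[of n k] by (simp add: has_bochner_integral_iff c_def mult_ac)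
  qed
  define r where "r = root (2 * p) (1 / 2)"
  have r: "0 < r" "r ^ (2 * p) = 1 / 2" "r < 1"
    using p0 by (auto simp: r_def)
  have AE: "AE \<omega> in white_noise. \<forall>N. \<exists>A. \<forall>n k. k < N * 2 ^ n \<longrightarrow> \<bar>D n k \<omega>\<bar> \<le> A * r ^ n"
  proof (rule AE_dyadic_increments[OF _ _ le p0 r(1,2)])
    show "D n k \<in> borel_measurable white_noise" for n k
      unfolding D_def using Xm by auto
    show "integrable white_noise (\<lambda>\<omega>. D n k \<omega> ^ (2 * p))" for n k
      using D[of n k] by (simp add: has_bochner_integral_iff)
  qed
  then obtain Z where Z: "{\<omega> \<in> space white_noise. \<not> (\<forall>N. \<exists>A. \<forall>n k. k < N * 2 ^ n \<longrightarrow> \<bar>D n k \<omega>\<bar> \<le> A * r ^ n)} \<subseteq> Z"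
    "emeasure white_noise Z = 0" "Z \<in> sets white_noise"
    by (rule AE_E)
  define k where "k n t = nat \<lfloor>2 ^ n * t\<rfloor>" for n :: nat and t :: real
  \<comment> \<open>The value 0 on the null set Z makes every path continuous, as
    \<open>continuous_paths\<close> demands, not merely almost every one.\<close>
  define \<theta> where "\<theta> t \<omega> = (if \<omega> \<in> Z then 0 else lim (\<lambda>n. X (d n (k n t)) \<omega>))" for t \<omega>
  have chain: "dyadic_chaining (\<lambda>n k. X (d n k) \<omega>) r" if "\<omega> \<in> space white_noise" "\<omega> \<notin> Z" for \<omega>
  proof
    show "X (d (Suc n) (2 * k)) \<omega> = X (d n k) \<omega>" for n k
      by (simp add: d_def)
    show "\<exists>A. \<forall>n k. k < N * 2 ^ n \<longrightarrow> \<bar>X (d n (Suc k)) \<omega> - X (d n k) \<omega>\<bar> \<le> A * r ^ n" for N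
    proof -
      have "\<forall>N. \<exists>A. \<forall>n k. k < N * 2 ^ n \<longrightarrow> \<bar>D n k \<omega>\<bar> \<le> A * r ^ n"
        using that Z(1) by blast
      then show ?thesis
        unfolding D_def by blast
    qed
  qed (use r in auto)
  have conv: "(\<lambda>n. X (d n (k n t)) \<omega>) \<longlonglongrightarrow> \<theta> t \<omega>" if "\<omega> \<in> space white_noise" "\<omega> \<notin> Z" "0 \<le> t" for \<omega> t
    using dyadic_chaining.convergent_step[OF chain[OF that(1,2)] that(3)] that(2)
    by (simp add: dyadic_chaining.step_def[OF chain[OF that(1,2)]] k_def \<theta>_def)
  have "continuous_on {0..} (\<lambda>t. \<theta> t \<omega>)" if "\<omega> \<in> space white_noise" for \<omega>
  proof (cases "\<omega> \<in> Z")
    case False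
    show ?thesis
      using dyadic_chaining.continuous_on_lim_step[OF chain[OF that False]] False
      by (simp add: dyadic_chaining.step_def[OF chain[OF that False]] k_def \<theta>_def)
  qed (simp add: \<theta>_def)
  then have paths: "continuous_paths white_noise \<theta>"
    by (simp add: continuous_paths_def)
  have "gaussian_family white_noise {0..} \<theta> C"
  proof (rule gaussian_family_limit)
    show "gaussian_family white_noise {0..} (\<lambda>t. X (d n (k n t))) (\<lambda>s t. C (d n (k n s)) (d n (k n t)))" for n
      by (rule gaussian_family_reindex[OF X]) (use T in auto)
    \<comment> \<open>Setting the approximants to 0 on the measurable set Z makes them converge at
      every sample point, so measurability passes to the limit.\<close>
    show "\<theta> t \<in> borel_measurable white_noise" if "t \<in> {0..}" for t
    proof (rule borel_measurable_LIMSEQ_real)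
      show "(\<lambda>\<omega>. if \<omega> \<in> Z then 0 else X (d n (k n t)) \<omega>) \<in> borel_measurable white_noise" for n
        using Xm Z(3) by (intro measurable_If_set) auto
      show "(\<lambda>n. if \<omega> \<in> Z then 0 else X (d n (k n t)) \<omega>) \<longlonglongrightarrow> \<theta> t \<omega>" if "\<omega> \<in> space white_noise" for \<omega>
      proof (cases "\<omega> \<in> Z")
        case False
        then show ?thesis
          using conv[OF that False] \<open>t \<in> {0..}\<close> by simp
      qed (simp add: \<theta>_def)
    qed
    show "AE \<omega> in white_noise. (\<lambda>n. X (d n (k n t)) \<omega>) \<longlonglongrightarrow> \<theta> t \<omega>" if "t \<in> {0..}" for t
      by (rule AE_I[OF _ Z(2,3)]) (use conv that in auto)
    have dk: "(\<lambda>n. d n (k n t)) \<longlonglongrightarrow> t" if "0 \<le> t" for t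
    proof (rule tendsto_sandwich)
      have "t - 1 / 2 ^ n \<le> d n (k n t)" "d n (k n t) \<le> t" for n
      proof -
        have "0 \<le> 2 ^ n * t" using that by simp
        then have "real (k n t) \<le> 2 ^ n * t" "2 ^ n * t - 1 \<le> real (k n t)"
          unfolding k_def by linarith+
        then have "(2 ^ n * t - 1) / 2 ^ n \<le> d n (k n t)" and "d n (k n t) \<le> 2 ^ n * t / 2 ^ n"
          unfolding d_def by (intro divide_right_mono; simp)+
        then show "t - 1 / 2 ^ n \<le> d n (k n t)" "d n (k n t) \<le> t"
          by (auto simp: diff_divide_distrib)
      qed
      then show "\<forall>\<^sub>F n in sequentially. t - (1 / 2) ^ n \<le> d n (k n t)" "\<forall>\<^sub>F n in sequentially. d n (k n t) \<le> t"
        by (auto simp: power_divide)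
      have "(\<lambda>n. t - (1 / 2) ^ n) \<longlonglongrightarrow> t - 0"
        by (intro tendsto_intros LIMSEQ_realpow_zero) auto
      then show "(\<lambda>n. t - (1 / 2) ^ n) \<longlonglongrightarrow> t" by simp
    qed simp
    show "(\<lambda>n. C (d n (k n s)) (d n (k n t))) \<longlonglongrightarrow> C s t" if "s \<in> {0..}" "t \<in> {0..}" for s t
      using that by (intro cont dk) (auto simp: d_def)
  qed
  then show ?thesis
    using paths by blast
qed

subsection \<open>Integrating the process\<close>

text \<open>Common core of the two Riemann sum arguments, for paths in one variable and for the
  kernel in two: g holds the values at mean value points, where the weighted sum equals the limit
  exactly.\<close>

lemma weighted_sums_tendsto:
  fixes w f g :: "nat \<Rightarrow> 'i \<Rightarrow> real"
  assumes w: "\<And>n i. i \<in> I n \<Longrightarrow> 0 \<le> w n i" and W: "\<And>n. (\<Sum>i\<in>I n. w n i) \<le> W"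
    and L: "\<And>n. (\<Sum>i\<in>I n. w n i * g n i) = L"
    and close: "\<And>e. 0 < e \<Longrightarrow> \<forall>\<^sub>F n in sequentially. \<forall>i\<in>I n. \<bar>f n i - g n i\<bar> \<le> e"
  shows "(\<lambda>n. \<Sum>i\<in>I n. w n i * f n i) \<longlonglongrightarrow> L"
proof (rule tendstoI)
  fix e :: real assume e: "0 < e"
  \<comment> \<open>V replaces W as a divisor because W may be 0.\<close>
  define V where "V = \<bar>W\<bar> + 1"
  define d where "d = e / (2 * V)"
  have V: "0 < V" "W \<le> V" by (auto simp: V_def)
  have d: "0 < d" using e V by (simp add: d_def)
  have dW: "W * d < e"
  proof -
    have "W * d \<le> V * d"
      using d V by (intro mult_right_mono) auto
    also have "\<dots> = e / 2"
      using V by (simp add: d_def)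
    finally show ?thesis using e by simp
  qed
  show "\<forall>\<^sub>F n in sequentially. dist (\<Sum>i\<in>I n. w n i * f n i) L < e"
    using close[OF d]
  proof eventually_elim
    case (elim n)
    have "\<bar>(\<Sum>i\<in>I n. w n i * f n i) - L\<bar> = \<bar>\<Sum>i\<in>I n. w n i * (f n i - g n i)\<bar>"
      unfolding L[of n, symmetric] by (simp add: sum_subtractf right_diff_distrib)
    also have "\<dots> \<le> (\<Sum>i\<in>I n. w n i * d)"
      using w elim by (intro order_trans[OF sum_abs] sum_mono) (auto simp: abs_mult intro!: mult_left_mono)
    also have "\<dots> \<le> W * d"
      unfolding sum_distrib_right[symmetric] using W d by (intro mult_right_mono) auto
    finally show ?case
      using dW by (simp add: dist_real_def)
  qed
qed

lemma div_Suc_less_eventually: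
  assumes "0 < (d::real)"
  shows "\<forall>\<^sub>F n in sequentially. t / real (Suc n) < d"
proof -
  have "(\<lambda>n. t / real (Suc n)) \<longlonglongrightarrow> 0"
    by (rule lim_const_over_n[THEN LIMSEQ_Suc])
  then show ?thesis
    using assms by (rule order_tendstoD(2))
qed

text \<open>By the mean value theorem the integral is itself a sum of values of \<open>f\<close>, taken at other points
  of the same cells.\<close>

lemma riemann_sums_tendsto_integral:
  fixes f :: "real \<Rightarrow> real"
  assumes t: "0 \<le> t" and f: "continuous_on {0..t} f"
  shows "(\<lambda>n. \<Sum>k<Suc n. t / real (Suc n) * f (real k * t / real (Suc n))) \<longlonglongrightarrow> integral {0..t} f"
proof (cases "t = 0")
  case False
  then have t: "0 < t" using t by simp
  define F where "F x = integral {0..x} f" for x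
  define u where "u n k = real k * t / real (Suc n)" for n k
  have u: "u n k < u n (Suc k)" "u n (Suc k) - u n k = t / real (Suc n)" "0 \<le> u n k" for n k
  proof -
    show diff: "u n (Suc k) - u n k = t / real (Suc n)"
      unfolding u_def diff_divide_distrib[symmetric] left_diff_distrib[symmetric] by simp
    have "0 < t / real (Suc n)"
      using t by simp
    then show "u n k < u n (Suc k)"
      using diff by linarith
    show "0 \<le> u n k"
      using t by (simp add: u_def)
  qed
  have ut: "u n k \<le> t" if "k \<le> Suc n" for n k
    using that t by (simp add: u_def divide_le_eq mult.commute mult_left_mono)
  have "\<exists>\<xi>. u n k < \<xi> \<and> \<xi> < u n (Suc k) \<and> F (u n (Suc k)) - F (u n k) = t / real (Suc n) * f \<xi>"
    if k: "k < Suc n" for n k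
  proof -
    have "\<exists>\<xi>>u n k. \<xi> < u n (Suc k) \<and> F (u n (Suc k)) - F (u n k) = (u n (Suc k) - u n k) * f \<xi>"
    proof (rule mvt_simple[OF u(1)[of n k], of F "\<lambda>x h. h * f x", unfolded Bex_def, simplified, THEN ex_forward])
      fix x assume "u n k \<le> x" "x \<le> u n (Suc k)"
      then have x: "x \<in> {0..t}"
        using u(3)[of n k] ut[of "Suc k" n] k by auto
      have "(F has_vector_derivative f x) (at x within {0..t})"
        unfolding F_def by (rule integral_has_vector_derivative[OF f x])
      then have "(F has_vector_derivative f x) (at x within {u n k..u n (Suc k)})"
        by (rule has_vector_derivative_within_subset) (use u(3)[of n k] ut[of "Suc k" n] k in auto)
      then show "(F has_derivative (\<lambda>h. h * f x)) (at x within {u n k..u n (Suc k)})"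
        by (simp add: has_vector_derivative_def)
    qed auto
    then show ?thesis using u(2) by auto
  qed
  note ex = this
  define \<xi> where "\<xi> n k = (SOME \<xi>. u n k < \<xi> \<and> \<xi> < u n (Suc k) \<and>
      F (u n (Suc k)) - F (u n k) = t / real (Suc n) * f \<xi>)" for n k
  have \<xi>: "u n k < \<xi> n k \<and> \<xi> n k < u n (Suc k) \<and>
      F (u n (Suc k)) - F (u n k) = t / real (Suc n) * f (\<xi> n k)" if "k < Suc n" for n k
    unfolding \<xi>_def by (rule someI_ex[OF ex[OF that]])
  have "(\<lambda>n. \<Sum>k<Suc n. t / real (Suc n) * f (u n k)) \<longlonglongrightarrow> F t"
  proof (rule weighted_sums_tendsto[where W=t and g="\<lambda>n k. f (\<xi> n k)"])
    show "(\<Sum>k<Suc n. t / real (Suc n) * f (\<xi> n k)) = F t" for n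
    proof -
      have "(\<Sum>k<Suc n. t / real (Suc n) * f (\<xi> n k)) = (\<Sum>k<Suc n. F (u n (Suc k)) - F (u n k))"
        using \<xi>[of _ n] by (intro sum.cong) auto
      also have "\<dots> = F (u n (Suc n)) - F (u n 0)"
        by (rule sum_lessThan_telescope)
      also have "\<dots> = F t"
        by (simp add: u_def F_def del: of_nat_Suc)
      finally show ?thesis .
    qed
    fix e :: real assume "0 < e"
    have "uniformly_continuous_on {0..t} f"
      using f by (rule compact_uniformly_continuous) simp
    then obtain d where d: "0 < d" "\<And>x y. x \<in> {0..t} \<Longrightarrow> y \<in> {0..t} \<Longrightarrow> dist x y < d \<Longrightarrow> dist (f x) (f y) < e"
      unfolding uniformly_continuous_on_def using \<open>0 < e\<close> by metis
    from div_Suc_less_eventually[OF d(1), of t]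
    show "\<forall>\<^sub>F n in sequentially. \<forall>k\<in>{..<Suc n}. \<bar>f (u n k) - f (\<xi> n k)\<bar> \<le> e"
    proof eventually_elim
      case (elim n)
      have "\<bar>f (u n k) - f (\<xi> n k)\<bar> \<le> e" if k: "k < Suc n" for k
      proof -
        have "u n k \<in> {0..t}" "\<xi> n k \<in> {0..t}" "dist (u n k) (\<xi> n k) < d"
          using \<xi>[OF k] u[of n k] ut[of "Suc k" n] k elim by (auto simp: dist_real_def)
        then show ?thesis
          using d(2) by (fastforce simp: dist_real_def)
      qed
      then show ?case by simp
    qed
  qed (use t in auto)
  then show ?thesis
    by (simp add: u_def F_def)
qed simp

section \<open>The kernel \<open>K0\<close> as a mixed derivative of \<open>K\<close>\<close>

text \<open>The argument s - t changes sign across the diagonal, so two-sided derivatives are needed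
  even at 0. There the difference quotients are sgn x |x|^(p-1) and |x|^(p-1), which tend to 0
  because p > 1.\<close>

lemma DERIV_abs_powr:
  assumes p: "1 < p"
  shows "((\<lambda>x. \<bar>x\<bar> powr p) has_real_derivative p * (sgn x * \<bar>x\<bar> powr (p - 1))) (at x)"
    and "((\<lambda>x. sgn x * \<bar>x\<bar> powr p) has_real_derivative p * \<bar>x\<bar> powr (p - 1)) (at x)"
proof -
  have "((\<lambda>x. \<bar>x\<bar> powr p) has_real_derivative p * (sgn x * \<bar>x\<bar> powr (p - 1))) (at x) \<and>
    ((\<lambda>x. sgn x * \<bar>x\<bar> powr p) has_real_derivative p * \<bar>x\<bar> powr (p - 1)) (at x)"
  proof (cases x "0::real" rule: linorder_cases)
    case greater
    have "\<forall>\<^sub>F y in nhds x. 0 < y"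
      using greater by (intro eventually_nhds_in_open[of "{0<..}", simplified]) auto
    then have ev: "\<forall>\<^sub>F y in nhds x. \<bar>y\<bar> powr p = y powr p" "\<forall>\<^sub>F y in nhds x. sgn y * \<bar>y\<bar> powr p = y powr p"
      by (auto elim!: eventually_mono)
    have "((\<lambda>y. y powr p) has_real_derivative p * x powr (p - 1)) (at x)"
      using greater by (rule has_real_derivative_powr)
    then show ?thesis
      using greater DERIV_cong_ev[OF refl ev(1) refl] DERIV_cong_ev[OF refl ev(2) refl] by simp
  next
    case less
    have "\<forall>\<^sub>F y in nhds x. y < 0"
      using less by (intro eventually_nhds_in_open[of "{..<0}", simplified]) auto
    then have ev: "\<forall>\<^sub>F y in nhds x. \<bar>y\<bar> powr p = (- y) powr p" "\<forall>\<^sub>F y in nhds x. sgn y * \<bar>y\<bar> powr p = - ((- y) powr p)"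
      by (auto elim!: eventually_mono)
    have "((\<lambda>y. (- y) powr p) has_real_derivative - (p * (- x) powr (p - 1))) (at x)"
      using less by (auto intro!: derivative_eq_intros simp: powr_diff)
    moreover from DERIV_minus[OF this] have "((\<lambda>y. - ((- y) powr p)) has_real_derivative p * (- x) powr (p - 1)) (at x)"
      by simp
    ultimately show ?thesis
      using less DERIV_cong_ev[OF refl ev(1) refl] DERIV_cong_ev[OF refl ev(2) refl] by simp
  next
    case equal
    have "((\<lambda>h::real. \<bar>h\<bar> powr (p - 1)) \<longlongrightarrow> \<bar>0\<bar> powr (p - 1)) (at 0)"
      using p by (intro tendsto_powr' tendsto_intros) auto
    then have lim: "((\<lambda>h::real. \<bar>h\<bar> powr (p - 1)) \<longlongrightarrow> 0) (at 0)"
      by simp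
    have split: "\<bar>h\<bar> powr p = \<bar>h\<bar> * \<bar>h\<bar> powr (p - 1)" for h :: real
      by (cases "h = 0") (auto simp: powr_diff)
    have "((\<lambda>h::real. sgn h * \<bar>h\<bar> powr (p - 1)) \<longlongrightarrow> 0) (at 0)"
      by (rule Lim_null_comparison[OF _ lim]) (auto simp: abs_mult abs_sgn_eq intro!: always_eventually)
    moreover have "\<forall>\<^sub>F h in at 0. sgn h * \<bar>h\<bar> powr (p - 1) = (\<bar>0 + h\<bar> powr p - \<bar>0\<bar> powr p) / h"
      "\<forall>\<^sub>F h in at 0. \<bar>h\<bar> powr (p - 1) = (sgn (0 + h) * \<bar>0 + h\<bar> powr p - sgn 0 * \<bar>0\<bar> powr p) / h"
      unfolding split by (auto simp: eventually_at_filter sgn_if split: if_splits intro!: always_eventually)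
    ultimately show ?thesis
      using lim equal p unfolding DERIV_def by (auto intro: Lim_transform_eventually)
  qed
  then show "((\<lambda>x. \<bar>x\<bar> powr p) has_real_derivative p * (sgn x * \<bar>x\<bar> powr (p - 1))) (at x)"
    and "((\<lambda>x. sgn x * \<bar>x\<bar> powr p) has_real_derivative p * \<bar>x\<bar> powr (p - 1)) (at x)"
    by auto
qed

text \<open>The mean value theorem is applied twice: to the difference of two sections in the first
  variable, then to the first partial derivative in the second. The pure power of t drops out by
  differentiation in s, and that of s drops out in the second difference.\<close>

lemma K_rectangle_increment:
  assumes h: "2 < h" and xy: "0 \<le> x" "x < x'" "0 \<le> y" "y < y'"
  shows "\<exists>\<xi> \<eta>. x < \<xi> \<and> \<xi> < x' \<and> y < \<eta> \<and> \<eta> < y' \<and>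
    K h x' y' - K h x y' - (K h x' y - K h x y) =
    (x' - x) * (y' - y) * (1/2 * h * (h - 1) * (h - 2) * K0 h \<xi> \<eta>)"
proof -
  \<comment> \<open>Absolute values extend \<open>K\<close> from the quadrant to the plane, so the
    derivatives exist in both directions also where x or y is 0.\<close>
  define k where "k s t = (2 - h) * (\<bar>s\<bar> powr h + \<bar>t\<bar> powr h - 1/2 * (\<bar>s + t\<bar> powr h + \<bar>s - t\<bar> powr h))" for s t
  define P where "P u = sgn u * \<bar>u\<bar> powr (h - 1)" for u
  define k1 where "k1 s t = (2 - h) * (h * P s - 1/2 * (h * P (s + t) + h * P (s - t)))" for s t
  have kK: "K h s t = k s t" if "0 \<le> s" "0 \<le> t" for s t
    using that by (simp add: K_def k_def)
  have D: "((\<lambda>s. \<bar>f s\<bar> powr h) has_real_derivative h * P (f s) * d) (at s)"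
    if "(f has_real_derivative d) (at s)" for f d s
    using DERIV_chain2[OF DERIV_abs_powr(1)[of h "f s"] that] h by (simp add: P_def)
  have DP: "((\<lambda>s. P (f s)) has_real_derivative (h - 1) * \<bar>f s\<bar> powr (h - 2) * d) (at s)"
    if "(f has_real_derivative d) (at s)" for f d s
    using DERIV_chain2[OF DERIV_abs_powr(2)[of "h - 1" "f s"] that] h by (simp add: P_def)
  have D0: "((\<lambda>s. \<bar>s\<bar> powr h) has_real_derivative h * P s * 1) (at s)" for s
    by (rule D) (auto intro!: derivative_eq_intros)
  have Dp: "((\<lambda>s. \<bar>s + t\<bar> powr h) has_real_derivative h * P (s + t) * 1) (at s)" for s t
    by (rule D) (auto intro!: derivative_eq_intros)
  have Dm: "((\<lambda>s. \<bar>s - t\<bar> powr h) has_real_derivative h * P (s - t) * 1) (at s)" for s t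
    by (rule D) (auto intro!: derivative_eq_intros)
  have "((\<lambda>s. k s y' - k s y) has_real_derivative k1 s y' - k1 s y) (at s)" for s
    unfolding k_def k1_def
    by (rule DERIV_cong, (rule D0 Dp Dm DERIV_diff DERIV_add DERIV_cmult DERIV_const)+) (simp add: algebra_simps)
  from MVT2[OF xy(2) this] obtain \<xi> where \<xi>: "x < \<xi>" "\<xi> < x'"
    and 1: "(k x' y' - k x' y) - (k x y' - k x y) = (x' - x) * (k1 \<xi> y' - k1 \<xi> y)"
    by auto
  let ?c = "1/2 * h * (h - 1) * (h - 2)"
  have DPp: "((\<lambda>t. P (s + t)) has_real_derivative (h - 1) * \<bar>s + t\<bar> powr (h - 2) * 1) (at t)" for s t
    by (rule DP) (auto intro!: derivative_eq_intros)
  have DPm: "((\<lambda>t. P (s - t)) has_real_derivative (h - 1) * \<bar>s - t\<bar> powr (h - 2) * -1) (at t)" for s t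
    by (rule DP) (auto intro!: derivative_eq_intros)
  have "((\<lambda>t. k1 \<xi> t) has_real_derivative ?c * (\<bar>\<xi> + t\<bar> powr (h - 2) - \<bar>\<xi> - t\<bar> powr (h - 2))) (at t)" for t
    unfolding k1_def
    by (rule DERIV_cong, (rule DPp DPm DERIV_diff DERIV_add DERIV_cmult DERIV_const)+) (simp add: field_simps)
  from MVT2[OF xy(4) this] obtain \<eta> where \<eta>: "y < \<eta>" "\<eta> < y'"
    and 2: "k1 \<xi> y' - k1 \<xi> y = (y' - y) * (?c * (\<bar>\<xi> + \<eta>\<bar> powr (h - 2) - \<bar>\<xi> - \<eta>\<bar> powr (h - 2)))"
    by auto
  have "K0 h \<xi> \<eta> = \<bar>\<xi> + \<eta>\<bar> powr (h - 2) - \<bar>\<xi> - \<eta>\<bar> powr (h - 2)"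
    using \<xi> \<eta> xy by (simp add: K0_def)
  then show ?thesis
    using 1 2 \<xi> \<eta> xy by (intro exI[of _ \<xi>] exI[of _ \<eta>]) (simp add: kK)
qed

lemma K0_eq_sine_kernel: "K0 h = sine_kernel (h - 2)"
  by (simp add: fun_eq_iff K0_def sine_kernel_def)

text \<open>The base |s - t| vanishes on the diagonal and s + t at the origin; there the limit rule
  for \<open>powr\<close> asks for a positive exponent and eventually nonnegative bases.\<close>

lemma sine_kernel_tendsto:
  fixes u v :: "'a \<Rightarrow> real"
  assumes \<alpha>: "0 < \<alpha>" and st: "0 \<le> s" "0 \<le> t"
    and uv: "\<forall>\<^sub>F n in F. 0 \<le> u n \<and> 0 \<le> v n" "(u \<longlongrightarrow> s) F" "(v \<longlongrightarrow> t) F"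
  shows "((\<lambda>n. sine_kernel \<alpha> (u n) (v n)) \<longlongrightarrow> sine_kernel \<alpha> s t) F"
  unfolding sine_kernel_def
proof (intro tendsto_diff tendsto_powr' disjI2 conjI \<alpha>)
  show "\<forall>\<^sub>F n in F. 0 \<le> u n + v n"
    using uv(1) by eventually_elim simp
qed (auto intro!: tendsto_intros uv)

lemma continuous_on_sine_kernel:
  assumes "0 < \<alpha>"
  shows "continuous_on ({0..} \<times> {0..}) (\<lambda>p. sine_kernel \<alpha> (fst p) (snd p))"
  unfolding continuous_on_def
proof
  fix p :: "real \<times> real" assume "p \<in> {0..} \<times> {0..}"
  then show "((\<lambda>p. sine_kernel \<alpha> (fst p) (snd p)) \<longlongrightarrow> sine_kernel \<alpha> (fst p) (snd p)) (at p within {0..} \<times> {0..})"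
    using assms by (intro sine_kernel_tendsto) (auto intro!: tendsto_intros always_eventually simp: eventually_at_filter mem_Times_iff)
qed

lemma K_zero: "0 \<le> s \<Longrightarrow> K h s 0 = 0" "0 \<le> t \<Longrightarrow> K h 0 t = 0"
  by (auto simp: K_def)

lemma K_sym: "K h s t = K h t s"
  by (simp add: K_def add.commute abs_minus_commute)

text \<open>\<open>K h s t\<close> is itself such a sum, with \<open>K0\<close> taken at interior
  points of the cells: the rectangle increments telescope in both directions. Uniform continuity of
  the kernel then allows the interior points to be exchanged for the lower corners.\<close>

lemma kernel_riemann_sums_tendsto:
  assumes h: "2 < h" and st: "0 \<le> s" "0 \<le> t"
  defines "c \<equiv> 1/2 * h * (h - 1) * (h - 2)"
  shows "(\<lambda>n. \<Sum>k<Suc n. \<Sum>l<Suc n. s / real (Suc n) * (t / real (Suc n)) *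
    (c * K0 h (real k * s / real (Suc n)) (real l * t / real (Suc n)))) \<longlonglongrightarrow> K h s t"
\<comment> \<open>The mean value step needs rectangles with positive sides, so the degenerate case
  is settled first; there both the sums and \<open>K\<close> vanish.\<close>
proof (cases "s = 0 \<or> t = 0")
  case True
  then show ?thesis using st K_zero by auto
next
  case False
  then have st: "0 < s" "0 < t" using st by auto
  define g where "g a n k = real k * a / real (Suc n)" for a :: real and n k
  have g: "g a n k < g a n (Suc k)" "g a n (Suc k) - g a n k = a / real (Suc n)" "0 \<le> g a n k" if "0 < a" for a n k
  proof -
    show diff: "g a n (Suc k) - g a n k = a / real (Suc n)"
      unfolding g_def diff_divide_distrib[symmetric] left_diff_distrib[symmetric] by simp
    have "0 < a / real (Suc n)"
      using that by simp
    then show "g a n k < g a n (Suc k)"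
      using diff by linarith
    show "0 \<le> g a n k"
      using that by (simp add: g_def)
  qed
  have gle: "g a n k \<le> a" if "0 < a" "k \<le> Suc n" for a n k
    using that by (simp add: g_def divide_le_eq mult.commute mult_left_mono)
  define R where "R n p = K h (g s n (Suc (fst p))) (g t n (Suc (snd p))) - K h (g s n (fst p)) (g t n (Suc (snd p))) -
    (K h (g s n (Suc (fst p))) (g t n (snd p)) - K h (g s n (fst p)) (g t n (snd p)))" for n and p :: "nat \<times> nat"
  define Q where "Q n p z \<longleftrightarrow> g s n (fst p) < fst z \<and> fst z < g s n (Suc (fst p)) \<and>
    g t n (snd p) < snd z \<and> snd z < g t n (Suc (snd p)) \<and>
    R n p = s / real (Suc n) * (t / real (Suc n)) * (c * K0 h (fst z) (snd z))" for n p and z :: "real \<times> real"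
  have "\<exists>z. Q n p z" for n p
    using K_rectangle_increment[OF h g(3)[OF st(1)] g(1)[OF st(1)] g(3)[OF st(2)] g(1)[OF st(2)], of n "fst p" n "snd p"]
    unfolding Q_def R_def c_def g(2)[OF st(1)] g(2)[OF st(2)] by auto
  then have Q: "Q n p (SOME z. Q n p z)" for n p
    by (rule someI_ex)
  define z where "z n p = (SOME z. Q n p z)" for n p
  let ?I = "\<lambda>n. {..<Suc n} \<times> {..<Suc n}"
  let ?w = "\<lambda>n (p :: nat \<times> nat). s / real (Suc n) * (t / real (Suc n))"
  have "(\<lambda>n. \<Sum>p\<in>?I n. ?w n p * (c * K0 h (g s n (fst p)) (g t n (snd p)))) \<longlonglongrightarrow> K h s t"
  proof (rule weighted_sums_tendsto[where W="s * t" and g="\<lambda>n p. c * K0 h (fst (z n p)) (snd (z n p))"])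
    show "(\<Sum>p\<in>?I n. ?w n p) \<le> s * t" for n
      by (simp add: card_cartesian_product del: of_nat_Suc mult_Suc mult_Suc_right)
    show "0 \<le> ?w n p" for n p
      using st by simp
    show "(\<Sum>p\<in>?I n. ?w n p * (c * K0 h (fst (z n p)) (snd (z n p)))) = K h s t" for n
    proof -
      have "(\<Sum>p\<in>?I n. ?w n p * (c * K0 h (fst (z n p)) (snd (z n p)))) = (\<Sum>p\<in>?I n. R n p)"
        using Q[of n] by (intro sum.cong) (auto simp: Q_def z_def)
      also have "\<dots> = (\<Sum>k<Suc n. \<Sum>l<Suc n. R n (k, l))"
        by (simp only: sum.cartesian_product split_def prod.collapse)
      also have "\<dots> = (\<Sum>k<Suc n. K h (g s n (Suc k)) (g t n (Suc n)) - K h (g s n k) (g t n (Suc n)) -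
          (K h (g s n (Suc k)) (g t n 0) - K h (g s n k) (g t n 0)))"
        unfolding R_def fst_conv snd_conv
        by (intro sum.cong refl sum_lessThan_telescope)
      \<comment> \<open>The lower boundary terms disappear because \<open>K\<close> vanishes on the
        axes.\<close>
      also have "\<dots> = (\<Sum>k<Suc n. K h (g s n (Suc k)) t - K h (g s n k) t)"
        using g(3)[OF st(1)] by (intro sum.cong refl) (simp add: g_def K_zero del: of_nat_Suc)
      also have "\<dots> = K h (g s n (Suc n)) t - K h (g s n 0) t"
        by (rule sum_lessThan_telescope)
      also have "\<dots> = K h s t"
        using st by (simp add: g_def K_zero del: of_nat_Suc)
      finally show ?thesis .
    qed
    fix e :: real assume "0 < e"
    have "continuous_on ({0..s} \<times> {0..t}) (\<lambda>p. c * K0 h (fst p) (snd p))"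
      unfolding K0_eq_sine_kernel using h
      by (intro continuous_on_mult_left continuous_on_subset[OF continuous_on_sine_kernel]) auto
    then have "uniformly_continuous_on ({0..s} \<times> {0..t}) (\<lambda>p. c * K0 h (fst p) (snd p))"
      by (rule compact_uniformly_continuous) (intro compact_Times compact_Icc)
    then obtain d where d: "0 < d" "\<And>p q. p \<in> {0..s} \<times> {0..t} \<Longrightarrow> q \<in> {0..s} \<times> {0..t} \<Longrightarrow> dist p q < d \<Longrightarrow>
        dist (c * K0 h (fst p) (snd p)) (c * K0 h (fst q) (snd q)) < e"
      unfolding uniformly_continuous_on_def using \<open>0 < e\<close> by metis
    \<comment> \<open>The distance in the plane is at most the sum of the two coordinate distances,
      hence half of d for each.\<close>
    have d2: "0 < d / 2"
      using d(1) by simp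
    show "\<forall>\<^sub>F n in sequentially. \<forall>p\<in>?I n. \<bar>c * K0 h (g s n (fst p)) (g t n (snd p)) - c * K0 h (fst (z n p)) (snd (z n p))\<bar> \<le> e"
      using div_Suc_less_eventually[OF d2, of s] div_Suc_less_eventually[OF d2, of t]
    proof eventually_elim
      case (elim n)
      show ?case
      proof
        fix p assume p: "p \<in> ?I n"
        have z: "g s n (fst p) < fst (z n p)" "fst (z n p) < g s n (Suc (fst p))"
          "g t n (snd p) < snd (z n p)" "snd (z n p) < g t n (Suc (snd p))"
          using Q[of n p] by (auto simp: Q_def z_def)
        have 1: "g s n (Suc (fst p)) \<le> s" "g t n (Suc (snd p)) \<le> t" "0 \<le> g s n (fst p)" "0 \<le> g t n (snd p)"
          using p st g(3) by (auto intro!: gle)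
        have 2: "g s n (Suc (fst p)) - g s n (fst p) < d / 2" "g t n (Suc (snd p)) - g t n (snd p) < d / 2"
          unfolding g(2)[OF st(1)] g(2)[OF st(2)] using elim by auto
        have "dist (g s n (fst p)) (fst (z n p)) < d / 2" "dist (g t n (snd p)) (snd (z n p)) < d / 2"
          using z 2 unfolding dist_real_def by linarith+
        moreover have "dist (g s n (fst p), g t n (snd p)) (z n p) \<le> dist (g s n (fst p)) (fst (z n p)) + dist (g t n (snd p)) (snd (z n p))"
          unfolding dist_prod_def by (simp add: sqrt_sum_squares_le_sum)
        ultimately have "dist (g s n (fst p), g t n (snd p)) (z n p) < d"
          by linarith
        moreover have "(g s n (fst p), g t n (snd p)) \<in> {0..s} \<times> {0..t}" "z n p \<in> {0..s} \<times> {0..t}"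
          using z 1 by (auto simp: mem_Times_iff)
        ultimately have "dist (c * K0 h (g s n (fst p)) (g t n (snd p))) (c * K0 h (fst (z n p)) (snd (z n p))) < e"
          using d(2)[of "(g s n (fst p), g t n (snd p))" "z n p"] by simp
        then show "\<bar>c * K0 h (g s n (fst p)) (g t n (snd p)) - c * K0 h (fst (z n p)) (snd (z n p))\<bar> \<le> e"
          by (simp add: dist_real_def)
      qed
    qed
  qed
  then show ?thesis
    by (simp only: sum.cartesian_product split_def g_def)
qed

text \<open>Continuity of the paths makes the Riemann sums converge at every sample point. This also
  supplies measurability of the integral, as a pointwise limit of finite combinations.\<close>

lemma gaussian_family_integrated_process:
  assumes h: "2 < h" and \<theta>: "gaussian_family N {0..} \<theta> (K0 h)" and paths: "continuous_paths N \<theta>"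
  shows "gaussian_family N {0..} (integrated_process h \<theta>) (K h)"
proof -
  define c where "c = 1/2 * h * (h - 1) * (h - 2)"
  have c: "0 \<le> c" "sqrt c * sqrt c = c"
    using h by (auto simp: c_def)
  interpret prob_space N
    by (rule gaussian_family_prob_space[OF \<theta>])
  define Y where "Y n t \<omega> = (\<Sum>k<Suc n. (sqrt c * (t / real (Suc n))) * \<theta> (real k * t / real (Suc n)) \<omega>)" for n t \<omega>
  have Y: "gaussian_family N {0..} (Y n) (\<lambda>s t. \<Sum>k<Suc n. \<Sum>l<Suc n.
      (sqrt c * (s / real (Suc n))) * (sqrt c * (t / real (Suc n))) *
      K0 h (real k * s / real (Suc n)) (real l * t / real (Suc n)))" for n
    unfolding Y_def by (rule gaussian_family_linear[OF \<theta>]) auto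
  have lim: "(\<lambda>n. Y n t \<omega>) \<longlonglongrightarrow> integrated_process h \<theta> t \<omega>" if "0 \<le> t" "\<omega> \<in> space N" for t \<omega>
  proof -
    have "continuous_on {0..t} (\<lambda>s. \<theta> s \<omega>)"
      using paths that by (auto simp: continuous_paths_def intro: continuous_on_subset)
    from tendsto_mult_left[OF riemann_sums_tendsto_integral[OF that(1) this], of "sqrt c"]
    show ?thesis
      by (simp only: Y_def integrated_process_def c_def sum_distrib_left mult.assoc)
  qed
  show ?thesis
  proof (rule gaussian_family_limit[OF Y])
    show "integrated_process h \<theta> t \<in> borel_measurable N" if "t \<in> {0..}" for t
    proof (rule borel_measurable_LIMSEQ_real)
      show "(\<lambda>n. Y n t \<omega>) \<longlonglongrightarrow> integrated_process h \<theta> t \<omega>" if "\<omega> \<in> space N" for \<omega>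
        using lim \<open>t \<in> {0..}\<close> that by simp
      show "Y n t \<in> borel_measurable N" for n
        by (rule gaussian_family_measurable[OF Y that])
    qed
    show "AE \<omega> in N. (\<lambda>n. Y n t \<omega>) \<longlonglongrightarrow> integrated_process h \<theta> t \<omega>" if "t \<in> {0..}" for t
      by (rule AE_I2, rule lim) (use that in auto)
    show "(\<lambda>n. \<Sum>k<Suc n. \<Sum>l<Suc n. (sqrt c * (s / real (Suc n))) * (sqrt c * (t / real (Suc n))) *
      K0 h (real k * s / real (Suc n)) (real l * t / real (Suc n))) \<longlonglongrightarrow> K h s t"
      if "s \<in> {0..}" "t \<in> {0..}" for s t
    proof -
      have "(sqrt c * a) * (sqrt c * b) * x = a * b * ((sqrt c * sqrt c) * x)" for a b x
        by (simp only: mult_ac)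
      then show ?thesis
        using kernel_riemann_sums_tendsto[OF h, of s t] that unfolding c_def[symmetric] by (simp only: atLeast_iff c(2))
    qed
  qed
qed

section \<open>Existence and representation\<close>

lemma ex_continuous_gaussian_family_K0:
  assumes "2 < h" and "h \<le> 4"
  shows "\<exists>\<theta>. gaussian_family white_noise {0..} \<theta> (K0 h) \<and> continuous_paths white_noise \<theta>"
  unfolding K0_eq_sine_kernel
proof (rule ex_continuous_gaussian_family[where \<alpha>="h - 2" and B=4])
  show "pos_semidef {0..} (sine_kernel (h - 2))"
    using assms by (intro pos_semidef_sine_kernel) auto
  show "sine_kernel (h - 2) s s + sine_kernel (h - 2) t t - 2 * sine_kernel (h - 2) s t \<le> 4 * \<bar>s - t\<bar> powr (h - 2)"
    if "0 \<le> s" "0 \<le> t" for s t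
    using assms that by (intro sine_kernel_increment_le) auto
  show "(\<lambda>n. sine_kernel (h - 2) (u n) (v n)) \<longlonglongrightarrow> sine_kernel (h - 2) s t"
    if "0 \<le> s" "0 \<le> t" "\<And>n. 0 \<le> u n \<and> 0 \<le> v n" "u \<longlonglongrightarrow> s" "v \<longlonglongrightarrow> t" for s t and u v :: "nat \<Rightarrow> real"
    using assms that by (intro sine_kernel_tendsto) auto
qed (use assms in auto)

theorem theorem3p1:
  fixes h :: real
  assumes "2 < h" and "h \<le> 4"
  shows
    "(\<exists>(M :: (real \<Rightarrow> real) measure) \<zeta>. centered_gaussian_process M \<zeta> (K h)) \<and>
     (\<exists>(N :: (real \<Rightarrow> real) measure) \<theta>.
        centered_gaussian_process N \<theta> (K0 h) \<and> continuous_paths N \<theta>) \<and>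
     (\<forall>(N :: 'b measure) \<theta>.
        centered_gaussian_process N \<theta> (K0 h) \<and> continuous_paths N \<theta> \<longrightarrow>
        centered_gaussian_process N (integrated_process h \<theta>) (K h) \<and>
        (\<forall>(M :: 'a measure) \<zeta>. centered_gaussian_process M \<zeta> (K h) \<longrightarrow>
           same_distribution M \<zeta> N (integrated_process h \<theta>)))"
proof -
  obtain \<theta> where \<theta>: "gaussian_family white_noise {0..} \<theta> (K0 h)" "continuous_paths white_noise \<theta>"
    using ex_continuous_gaussian_family_K0[OF assms] by blast
  have K0_sym: "K0 h s t = K0 h t s" for s t
    unfolding K0_eq_sine_kernel by (rule sine_kernel_sym)
  \<comment> \<open>The process \<zeta> is obtained as the integral itself, so positive
    semidefiniteness of \<open>K\<close> is inherited from \<open>K0\<close> and not proved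
    separately.\<close>
  have exK: "centered_gaussian_process white_noise (integrated_process h \<theta>) (K h)"
    by (rule centered_gaussian_process_if_gaussian_family[OF
          gaussian_family_integrated_process[OF assms(1) \<theta>] K_sym])
  have exK0: "centered_gaussian_process white_noise \<theta> (K0 h) \<and> continuous_paths white_noise \<theta>"
    using centered_gaussian_process_if_gaussian_family[OF \<theta>(1) K0_sym] \<theta>(2) by blast
  have int: "gaussian_family N {0..} (integrated_process h \<theta>) (K h)"
    if "centered_gaussian_process N \<theta> (K0 h) \<and> continuous_paths N \<theta>" for N :: "'b measure" and \<theta>
    using that by (intro gaussian_family_integrated_process[OF assms(1)]
        gaussian_family_if_centered_gaussian_process) auto
  show ?thesis
  proof (intro conjI allI impI)
    show "\<exists>(M :: (real \<Rightarrow> real) measure) \<zeta>. centered_gaussian_process M \<zeta> (K h)"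
      using exK by blast
    show "\<exists>(N :: (real \<Rightarrow> real) measure) \<theta>. centered_gaussian_process N \<theta> (K0 h) \<and> continuous_paths N \<theta>"
      using exK0 by blast
    fix N :: "'b measure" and \<theta>
    assume N: "centered_gaussian_process N \<theta> (K0 h) \<and> continuous_paths N \<theta>"
    show "centered_gaussian_process N (integrated_process h \<theta>) (K h)"
      by (rule centered_gaussian_process_if_gaussian_family[OF int[OF N] K_sym])
    fix M :: "'a measure" and \<zeta>
    assume "centered_gaussian_process M \<zeta> (K h)"
    \<comment> \<open>Both processes are Gaussian families with the same covariance
      \<open>K\<close>, possibly on different sample spaces; their finite-dimensional laws therefore
      agree.\<close>
    then show "same_distribution M \<zeta> N (integrated_process h \<theta>)"
      by (intro same_distribution_if_gaussian_family[OF _ int[OF N]]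
          gaussian_family_if_centered_gaussian_process)
  qed
qed

end
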